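(* Let $u$ be the solution of $u_t=\int_{\mathbb R^N} J(x-y)(u(y,t)-u(x,t))\,dy-u^p$ in $\mathbb R^N\times(0,\infty)$, $u(x,0)=u_0(x)$, and let $u^k(x,t)=f(k)\,u(kx,k^2t)$ be its rescaling. Let $k_n\to\infty$ and assume $u^{k_n}\to U$ as $n\to\infty$, uniformly on compact sets of $\mathbb R^N\times(0,\infty)$. Assume that for every $R>0$ there exists $C_R$ such that, for all $\tau>0$ and $k>0$, $$\int_0^\tau\!\int_{B_R}u^k(x,t)\,dx\,dt\le C_R\,\tau ,$$ and either there exists $\gamma>0$ such that, for all $\tau>0$ and $k>0$, $$F(k)\int_0^\tau\!\int_{B_R}(u^k)^p(x,t)\,dx\,dt\le C_R\,\tau^\gamma ,$$ or else, for every $R,\tau>0$, $$\lim_{k\to\infty}F(k)\int_0^\tau\!\int_{B_R}(u^k)^p(x,t)\,dx\,dt=0 .$$ Assume further that $u_0^k(x)=f(k)u_0(kx)\to\phi(x)$ as $k\to\infty$ in the sense of distributions. Then $U$ is the solution to $$U_t-\mathfrak a\Delta U=-c_0U^p,\qquad U(x,0)=\phi(x),$$ where $c_0=\lim_{k\to\infty}F(k)$.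
   Context: $J\in C_0^\infty(\mathbb R^N)$ is radially symmetric, $J\ge0$, $\int J=1$, $\mathfrak a=\frac1{2N}\int J(x)|x|^2\,dx$; $p>1$; $0\le u_0\in L^\infty(\mathbb R^N)$, $u_0\neq0$, and there is $\kappa>0$ with $\int_{B_k}u_0\ge\kappa k^N$ for small $k>0$, where $B_k$ is the ball of radius $k$ centered at $0$. Put $$f(k)=\frac{k^N}{\int_{B_k}u_0},\qquad F(k)=f(k)^{1-p}k^2 .$$ Assume: (F1) there is $B>0$ with $f(|x|)u_0(x)\le B$; (F2) with some fixed $k_0>0$, for every $\delta>0$ there is $C_\delta>0$ with $f(k)\le C_\delta f(l)$ whenever $k_0\le k\le l\delta^{-1}$; (F3) there is $c_0\ge0$ with $F(k)\to c_0$ as $k\to\infty$. Solutions $u$ are nonnegative. *)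

theory Defs
  imports "HOL-Analysis.Analysis"
begin

text \<open>
  The space \<open>\<real>\<^sup>N\<close> is an arbitrary type \<open>'a :: euclidean_space\<close> with \<open>N = DIM('a)\<close>, and
  space-time is the Euclidean space \<open>'a \<times> real\<close>. Elements of \<open>L\<^sup>\<infinity>\<close> are given by Borel
  representatives, so pointwise conditions on them hold almost everywhere.
\<close>

subsection \<open>Test functions\<close>

definition dir_deriv :: "'b::euclidean_space \<Rightarrow> ('b \<Rightarrow> real) \<Rightarrow> 'b \<Rightarrow> real" where
  "dir_deriv v f = (\<lambda>x. frechet_derivative f (at x) v)"

text \<open>
  \<open>C\<^sup>\<infinity>\<close> on the whole space: every iterated directional derivative, including the function
  itself (\<open>vs = []\<close>), is Frechet differentiable everywhere. In particular all of them
  are continuous.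
\<close>

definition smooth :: "('b::euclidean_space \<Rightarrow> real) \<Rightarrow> bool" where
  "smooth f \<longleftrightarrow> (\<forall>vs x. foldr dir_deriv vs f differentiable (at x))"

definition supp :: "('b::euclidean_space \<Rightarrow> real) \<Rightarrow> 'b set" where
  "supp f = closure {x. f x \<noteq> 0}"

definition test_function_on :: "'b::euclidean_space set \<Rightarrow> ('b \<Rightarrow> real) \<Rightarrow> bool" where
  "test_function_on \<Omega> \<psi> \<longleftrightarrow> smooth \<psi> \<and> compact (supp \<psi>) \<and> supp \<psi> \<subseteq> \<Omega>"

definition time_deriv :: "('a::euclidean_space \<times> real \<Rightarrow> real) \<Rightarrow> 'a \<times> real \<Rightarrow> real" where
  "time_deriv \<psi> = dir_deriv (0, 1) \<psi>"

definition space_laplacian :: "('a::euclidean_space \<times> real \<Rightarrow> real) \<Rightarrow> 'a \<times> real \<Rightarrow> real" where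
  "space_laplacian \<psi> = (\<lambda>z. \<Sum>b\<in>Basis. dir_deriv (b, 0) (dir_deriv (b, 0) \<psi>) z)"

text \<open>
  Distributions are represented by their action on test functions. A functional that is a
  limit in this sense is linear on test functions, and by the uniform boundedness
  principle it is continuous on them; these two properties need not be required of it.
\<close>

definition tendsto_distr ::
    "('i \<Rightarrow> 'a::euclidean_space \<Rightarrow> real) \<Rightarrow> (('a \<Rightarrow> real) \<Rightarrow> real) \<Rightarrow> 'i filter \<Rightarrow> bool" where
  "tendsto_distr g \<phi> \<F> \<longleftrightarrow>
     (\<forall>\<psi>. test_function_on UNIV \<psi> \<longrightarrow> ((\<lambda>i. LINT x|lborel. g i x * \<psi> x) \<longlongrightarrow> \<phi> \<psi>) \<F>)"

subsection \<open>The nonlocal problem and its rescaling\<close>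

definition diffusivity :: "('a::euclidean_space \<Rightarrow> real) \<Rightarrow> real" where
  "diffusivity J = 1 / (2 * real DIM('a)) * (LINT x|lborel. J x * (norm x)\<^sup>2)"

definition scale_f :: "('a::euclidean_space \<Rightarrow> real) \<Rightarrow> real \<Rightarrow> real" where
  "scale_f u0 k = k ^ DIM('a) / (LINT x:ball 0 k|lborel. u0 x)"

definition scale_F :: "real \<Rightarrow> ('a::euclidean_space \<Rightarrow> real) \<Rightarrow> real \<Rightarrow> real" where
  "scale_F p u0 k = scale_f u0 k powr (1 - p) * k\<^sup>2"

definition rescale_data :: "('a::euclidean_space \<Rightarrow> real) \<Rightarrow> real \<Rightarrow> 'a \<Rightarrow> real" where
  "rescale_data u0 k x = scale_f u0 k * u0 (k *\<^sub>R x)"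

definition rescale_sol ::
    "('a::euclidean_space \<Rightarrow> real) \<Rightarrow> ('a \<Rightarrow> real \<Rightarrow> real) \<Rightarrow> real \<Rightarrow> 'a \<Rightarrow> real \<Rightarrow> real" where
  "rescale_sol u0 u k x t = scale_f u0 k * u (k *\<^sub>R x) (k\<^sup>2 * t)"

text \<open>
  Nonnegative solutions in \<open>L\<^sup>\<infinity>(\<real>\<^sup>N \<times> (0,T))\<close> for every \<open>T\<close>. The equation contains no
  derivative in space, so for almost every \<open>x\<close> it is an ordinary differential equation in
  \<open>t\<close>, understood in the classical sense. Values of \<open>u\<close> at negative times are irrelevant.
\<close>

definition nonlocal_solution ::
    "('a::euclidean_space \<Rightarrow> real) \<Rightarrow> real \<Rightarrow> ('a \<Rightarrow> real) \<Rightarrow> ('a \<Rightarrow> real \<Rightarrow> real) \<Rightarrow> bool" where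
  "nonlocal_solution J p u0 u \<longleftrightarrow>
     (\<lambda>(x, t). u x t) \<in> borel_measurable (restrict_space borel (UNIV \<times> {0..})) \<and>
     (\<forall>T>0. \<exists>M. AE x in lborel. \<forall>t\<in>{0..T}. u x t \<le> M) \<and>
     (AE x in lborel.
        u x 0 = u0 x \<and> (\<forall>t\<ge>0. 0 \<le> u x t) \<and> continuous_on {0..} (u x) \<and>
        (\<forall>t>0. (u x has_real_derivative
           (LINT y|lborel. J (x - y) * (u y t - u x t)) - u x t powr p) (at t)))"

subsection \<open>The limit problem\<close>

text \<open>
  Nonnegative solutions of \<open>U\<^sub>t - a \<Delta>U = - c U\<^sup>p\<close> in \<open>\<real>\<^sup>N \<times> (0,\<infinity>)\<close> in the sense of
  distributions, with \<open>U(\<cdot>,t) \<rightarrow> \<phi>\<close> in the sense of distributions as \<open>t \<rightarrow> 0+\<close>. Both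
  \<open>U\<close> and \<open>c U\<^sup>p\<close> are required to be locally integrable up to \<open>t = 0\<close>, and \<open>U(\<cdot>,t)\<close> to be
  locally integrable for every \<open>t > 0\<close>, so none of the Bochner integrals below takes its
  default value 0.
\<close>

definition limit_solution ::
    "real \<Rightarrow> real \<Rightarrow> real \<Rightarrow> (('a::euclidean_space \<Rightarrow> real) \<Rightarrow> real) \<Rightarrow> ('a \<Rightarrow> real \<Rightarrow> real) \<Rightarrow> bool" where
  "limit_solution a c p \<phi> U \<longleftrightarrow>
     (AE x in lborel. \<forall>t>0. 0 \<le> U x t) \<and>
     (\<forall>R>0. \<forall>\<tau>>0. set_integrable lborel (ball 0 R \<times> {0<..<\<tau>}) (\<lambda>(x, t). U x t)) \<and>
     (\<forall>R>0. \<forall>\<tau>>0. set_integrable lborel (ball 0 R \<times> {0<..<\<tau>}) (\<lambda>(x, t). c * U x t powr p)) \<and>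
     (\<forall>R>0. \<forall>t>0. set_integrable lborel (ball 0 R) (\<lambda>x. U x t)) \<and>
     (\<forall>\<psi>. test_function_on (UNIV \<times> {0<..}) \<psi> \<longrightarrow>
        (LINT (x, t)|lborel. U x t * (- time_deriv \<psi> (x, t) - a * space_laplacian \<psi> (x, t))) =
        (LINT (x, t)|lborel. - c * U x t powr p * \<psi> (x, t))) \<and>
     tendsto_distr (\<lambda>t x. U x t) \<phi> (at_right 0)"

end

(*
  For the rescaled solutions v_n the jump kernel concentrates at the origin, and a second order
  Taylor expansion together with the moments of the radial kernel J shows that, on smooth functions
  compactly supported in space, the rescaled nonlocal operators converge uniformly to the Laplacian
  times the diffusivity. Testing the equation of v_n and moving the symmetric operator onto the test
  function leaves an identity whose limit is the weak form of the limit equation; near t = 0 the two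
  space-time bounds give integrability of the limit (Fatou) and, for test functions independent of
  time, control the distance of v_n(t) from its initial datum uniformly in n, which yields the
  initial trace.
*)
theory Submission
  imports Defs
begin

subsection \<open>Calculus of test functions\<close>

text \<open>Two obstacles shape the proof. Convergence is uniform only on compact sets of positive
  times, so no pointwise bound on the rescaled solutions that is uniform in n reaches t = 0; there
  only integral bounds survive. For test functions supported in t > 0 this is harmless. For the
  initial trace, n tends to infinity at a fixed time \<tau>, and only afterwards \<tau> tends to 0,
  which is why the error terms must be explicit in \<tau>. Secondly, the equation and the bounds
  hold for almost every x only. Each rescaled solution is therefore replaced by a representative
  that is Borel, nonnegative, bounded up to each time and continuous in time at every point, and it
  is compared with U on one common set of full measure. Boundedness of each single representative
  justifies every use of Fubini's theorem, although these bounds depend on n.\<close>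

lemma smooth_differentiable:
  assumes "smooth f" shows "f differentiable (at x)"
  using assms unfolding smooth_def by (metis foldr.simps(1) id_apply)

lemma smooth_dir_deriv:
  assumes "smooth f" shows "smooth (dir_deriv v f)"
  unfolding smooth_def
proof (intro allI)
  fix vs x
  have "foldr dir_deriv (vs @ [v]) f differentiable (at x)"
    using assms unfolding smooth_def by blast
  then show "foldr dir_deriv vs (dir_deriv v f) differentiable (at x)" by simp
qed

lemma smooth_continuous_on:
  assumes "smooth f" shows "continuous_on S f"
  using smooth_differentiable[OF assms]
  by (meson continuous_at_imp_continuous_on differentiable_imp_continuous_within)

lemma smooth_has_derivative:
  assumes "smooth f"
  shows "(f has_derivative (\<lambda>v. dir_deriv v f x)) (at x)"
  using smooth_differentiable[OF assms, of x] unfolding frechet_derivative_works dir_deriv_def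
  by (simp add: eta_contract_eq)

lemma dir_deriv_eqI:
  assumes "(f has_derivative f') (at x)" shows "dir_deriv v f x = f' v"
  using frechet_derivative_at[OF assms] by (simp add: dir_deriv_def)

lemma smooth_line_derivative:
  assumes "smooth f"
  shows "((\<lambda>s. f (x + s *\<^sub>R v)) has_real_derivative dir_deriv v f (x + s *\<^sub>R v)) (at s)"
proof -
  have "((\<lambda>s. f (x + s *\<^sub>R v)) has_derivative (\<lambda>h. dir_deriv (h *\<^sub>R v) f (x + s *\<^sub>R v))) (at s)"
    by (rule has_derivative_compose[OF _ smooth_has_derivative[OF assms]])
       (auto intro!: derivative_eq_intros)
  moreover have "dir_deriv (h *\<^sub>R v) f (x + s *\<^sub>R v) = dir_deriv v f (x + s *\<^sub>R v) * h" for h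
    using linear_cmul[OF linear_frechet_derivative[OF smooth_differentiable[OF assms]]]
    by (simp add: dir_deriv_def)
  ultimately show ?thesis
    by (simp add: has_field_derivative_def)
qed

lemma smooth_space_derivative:
  fixes f :: "'a::euclidean_space \<times> real \<Rightarrow> real"
  assumes "smooth f"
  shows "((\<lambda>s. f (x + s *\<^sub>R z, t)) has_real_derivative
    (\<Sum>b\<in>Basis. (z \<bullet> b) * dir_deriv (b, 0) f (x + s *\<^sub>R z, t))) (at s)"
proof -
  let ?y = "(x + s *\<^sub>R z, t)"
  have lin: "linear (frechet_derivative f (at ?y))"
    by (rule linear_frechet_derivative[OF smooth_differentiable[OF assms]])
  have z: "(z, 0) = (\<Sum>b\<in>Basis. (z \<bullet> b) *\<^sub>R (b, 0::real))"
    by (simp add: prod_eq_iff fst_sum snd_sum euclidean_representation)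
  have "dir_deriv (z, 0) f ?y = (\<Sum>b\<in>Basis. (z \<bullet> b) * dir_deriv (b, 0) f ?y)"
    unfolding dir_deriv_def z linear_sum[OF lin] linear_cmul[OF lin] by simp
  then show ?thesis
    using smooth_line_derivative[OF assms, of "(x, t)" "(z, 0)" s] by simp
qed

lemma smooth_time_derivative:
  fixes f :: "'a::euclidean_space \<times> real \<Rightarrow> real"
  assumes "smooth f"
  shows "((\<lambda>t. f (x, t)) has_real_derivative time_deriv f (x, t)) (at t)"
  using smooth_line_derivative[OF assms, of "(x, 0)" "(0, 1)" t] by (simp add: time_deriv_def)

text \<open>Lets a test function of space alone enter the space-time arguments, as the initial trace
  requires. Functions of the form \<open>g (fst z)\<close> with \<open>g\<close> smooth are closed
  under directional derivatives, so the induction over the list of directions never leaves this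
  form.\<close>

lemma smooth_compose_fst:
  fixes f :: "'a::euclidean_space \<Rightarrow> real"
  assumes "smooth f"
  shows "smooth (\<lambda>z :: 'a \<times> real. f (fst z))"
proof -
  have *: "dir_deriv w (\<lambda>z :: 'a \<times> real. g (fst z)) = (\<lambda>z. dir_deriv (fst w) g (fst z))"
    if "smooth g" for w g
  proof
    fix z :: "'a \<times> real"
    show "dir_deriv w (\<lambda>z. g (fst z)) z = dir_deriv (fst w) g (fst z)"
      by (rule dir_deriv_eqI, rule has_derivative_compose[OF _ smooth_has_derivative[OF that]])
         (auto intro!: derivative_eq_intros)
  qed
  have "\<exists>g. smooth g \<and> foldr dir_deriv vs (\<lambda>z :: 'a \<times> real. f (fst z)) = (\<lambda>z. g (fst z))" for vs
  proof (induction vs)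
    case Nil
    then show ?case using assms by auto
  next
    case (Cons w vs)
    then obtain g where "smooth g"
      "foldr dir_deriv vs (\<lambda>z :: 'a \<times> real. f (fst z)) = (\<lambda>z. g (fst z))" by blast
    then show ?case using *[of g w] smooth_dir_deriv[of g "fst w"] by auto
  qed
  moreover have "(\<lambda>z :: 'a \<times> real. g (fst z)) differentiable (at x)" if "smooth g" for g x
    by (rule differentiableI, rule has_derivative_compose[OF _ smooth_has_derivative[OF that]])
         (auto intro!: derivative_eq_intros)
  ultimately show ?thesis unfolding smooth_def by metis
qed

lemma dir_deriv_zero_on_open:
  assumes "open S" "\<And>z. z \<in> S \<Longrightarrow> f z = 0" "z \<in> S"
  shows "dir_deriv v f z = 0"
proof -
  have "(f has_derivative (\<lambda>_. 0)) (at z)"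
    by (rule has_derivative_transform_within_open[of "\<lambda>_. 0" _ _ _ S]) (use assms in auto)
  then show ?thesis by (rule dir_deriv_eqI)
qed

section \<open>Functions compactly supported in space\<close>

text \<open>Only the support in space is confined, so that functions constant in time qualify;
  compactness in time comes from restricting to \<open>{0..T}\<close>.\<close>

definition vanishes_off :: "real \<Rightarrow> ('a::euclidean_space \<times> real \<Rightarrow> real) \<Rightarrow> bool" where
  "vanishes_off R f \<longleftrightarrow> (\<forall>x t. x \<notin> cball 0 R \<longrightarrow> f (x, t) = 0)"

lemma vanishes_off_dir_deriv:
  assumes "vanishes_off R f" shows "vanishes_off R (dir_deriv v f)"
  unfolding vanishes_off_def
proof (intro allI impI)
  fix x :: 'a and t :: real assume "x \<notin> cball 0 R"
  moreover have "open ((- cball 0 R) \<times> (UNIV :: real set))" by (intro open_Times) auto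
  ultimately show "dir_deriv v f (x, t) = 0"
    by (rule_tac dir_deriv_zero_on_open[of "(- cball 0 R) \<times> UNIV"])
       (use assms in \<open>auto simp: vanishes_off_def\<close>)
qed

lemma vanishes_off_bounded:
  fixes f :: "'a::euclidean_space \<times> real \<Rightarrow> real"
  assumes "continuous_on UNIV f" "vanishes_off R f"
  obtains C where "0 \<le> C" "\<And>x t. t \<in> {0..T} \<Longrightarrow> \<bar>f (x, t)\<bar> \<le> C"
proof -
  have "bounded (f ` (cball 0 R \<times> {0..T}))"
    by (intro compact_imp_bounded compact_continuous_image compact_Times
        continuous_on_subset[OF assms(1)]) auto
  then obtain C where C: "\<forall>z \<in> cball 0 R \<times> {0..T}. \<bar>f z\<bar> \<le> C"
    unfolding bounded_iff by auto
  show ?thesis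
  proof (rule that[of "max C 0"])
    show "\<bar>f (x, t)\<bar> \<le> max C 0" if "t \<in> {0..T}" for x t
      using C assms(2) that unfolding vanishes_off_def by (cases "x \<in> cball 0 R") (auto simp: le_max_iff_disj)
  qed simp
qed

lemma vanishes_off_uniformly_continuous:
  fixes f :: "'a::euclidean_space \<times> real \<Rightarrow> real"
  assumes "continuous_on UNIV f" "vanishes_off R f" "0 < e"
  obtains d where "0 < d" "\<And>x y t. t \<in> {0..T} \<Longrightarrow> dist y x < d \<Longrightarrow> \<bar>f (y, t) - f (x, t)\<bar> < e"
proof -
  \<comment> \<open>The extra width 1 leaves two cases for points closer than 1: both lie in the
    larger ball, or both lie outside the ball of radius \<open>R\<close>, where \<open>f\<close> is
    0.\<close>
  have "uniformly_continuous_on (cball 0 (R + 1) \<times> {0..T}) f"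
    by (intro compact_uniformly_continuous continuous_on_subset[OF assms(1)] compact_Times) auto
  then obtain d where d: "0 < d" "\<And>z w. z \<in> cball 0 (R + 1) \<times> {0..T} \<Longrightarrow>
      w \<in> cball 0 (R + 1) \<times> {0..T} \<Longrightarrow> dist w z < d \<Longrightarrow> dist (f w) (f z) < e"
    using \<open>0 < e\<close> unfolding uniformly_continuous_on_def by metis
  show ?thesis
  proof (rule that[of "min d 1"])
    fix x y :: 'a and t assume t: "t \<in> {0..T}" and xy: "dist y x < min d 1"
    show "\<bar>f (y, t) - f (x, t)\<bar> < e"
    proof (cases "x \<in> cball 0 (R + 1) \<and> y \<in> cball 0 (R + 1)")
      case True
      then show ?thesis using d(2)[of "(x, t)" "(y, t)"] t xy
        by (auto simp: dist_real_def dist_prod_def)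
    next
      case False
      have "norm x \<le> norm y + dist y x" "norm y \<le> norm x + dist y x"
        by (metis dist_norm norm_triangle_sub norm_minus_commute)+
      then have "x \<notin> cball 0 R" "y \<notin> cball 0 R" using False xy by auto
      then show ?thesis using assms unfolding vanishes_off_def by simp
    qed
  qed (use d in auto)
qed

section \<open>Second order Taylor expansion in space\<close>

text \<open>The quadratic form of the spatial Hessian at \<open>(x, t)\<close> in the direction
  \<open>z\<close>, that is, the second derivative of \<open>f\<close> along the line through
  \<open>x\<close> with velocity \<open>z\<close>.\<close>

definition hess :: "('a::euclidean_space \<times> real \<Rightarrow> real) \<Rightarrow> 'a \<Rightarrow> 'a \<Rightarrow> real \<Rightarrow> real" where
  "hess f z x t = (\<Sum>b\<in>Basis. \<Sum>c\<in>Basis. (z \<bullet> b) * (z \<bullet> c) * dir_deriv (c, 0) (dir_deriv (b, 0) f) (x, t))"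

text \<open>Maclaurin's formula is applied once, to the sum of the values along \<open>z\<close> and
  along \<open>- z\<close>. The first derivatives at 0 cancel, and both Hessians are evaluated at
  the same distance \<open>\<xi>\<close>. The remainder is exact, so uniform continuity of the
  second derivatives is enough later.\<close>

lemma second_difference:
  fixes f :: "'a::euclidean_space \<times> real \<Rightarrow> real"
  assumes "smooth f" "0 < h"
  obtains \<xi> where "0 < \<xi>" "\<xi> < h"
    "f (x + h *\<^sub>R z, t) + f (x - h *\<^sub>R z, t) - 2 * f (x, t) =
      h\<^sup>2 / 2 * (hess f z (x + \<xi> *\<^sub>R z) t + hess f z (x - \<xi> *\<^sub>R z) t)"
proof -
  define d where "d z s = (\<Sum>b\<in>Basis. (z \<bullet> b) * dir_deriv (b, 0) f (x + s *\<^sub>R z, t))" for z s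
  have D1: "((\<lambda>s. f (x + s *\<^sub>R z, t)) has_real_derivative d z s) (at s)" for z s
    unfolding d_def by (rule smooth_space_derivative[OF assms(1)])
  have D2: "(d z has_real_derivative hess f z (x + s *\<^sub>R z) t) (at s)" for z s
    unfolding d_def[abs_def]
    by (rule derivative_eq_intros smooth_space_derivative smooth_dir_deriv assms(1) refl)+
       (simp add: hess_def sum_distrib_left sum_distrib_right ac_simps)
  \<comment> \<open>The successive derivatives demanded by Maclaurin's formula. The backward branch
    is written as motion along \<open>- z\<close>, so that \<open>D1\<close> and \<open>D2\<close>
    apply to it unchanged; subtracting \<open>2 * f (x, t)\<close> removes the term of order
    0.\<close>
  define diff where "diff m s =
    (if m = 0 then f (x + s *\<^sub>R z, t) + f (x + s *\<^sub>R (- z), t) - 2 * f (x, t)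
     else if m = 1 then d z s + d (- z) s
     else hess f z (x + s *\<^sub>R z) t + hess f (- z) (x + s *\<^sub>R (- z)) t)" for m :: nat and s
  have "DERIV (diff m) s :> diff (Suc m) s" if "m < 2" for m s
  proof (cases "m = 0")
    case True
    then show ?thesis unfolding diff_def
      using D1[of z s] D1[of "- z" s] by (auto intro!: derivative_eq_intros simp del: scaleR_minus_right)
  next
    case False
    then have "m = 1" using that by simp
    then show ?thesis unfolding diff_def
      using D2[of z s] D2[of "- z" s] by (auto intro!: derivative_eq_intros simp del: scaleR_minus_right)
  qed
  then obtain \<xi> where \<xi>: "0 < \<xi>" "\<xi> < h"
    and eq: "diff 0 h = (\<Sum>m<2. diff m 0 / fact m * h ^ m) + diff 2 \<xi> / fact 2 * h ^ 2"
    using Maclaurin[OF \<open>0 < h\<close>, of 2 diff "diff 0"] by auto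
  have "d (- z) 0 = - d z 0" by (simp add: d_def sum_negf)
  then have "(\<Sum>m<2. diff m 0 / fact m * h ^ m) = 0"
    by (simp add: diff_def numeral_2_eq_2)
  moreover have "hess f (- z) = hess f z" by (simp add: hess_def fun_eq_iff)
  ultimately show ?thesis using \<xi> eq by (intro that[of \<xi>]) (simp_all add: diff_def field_simps)
qed

text \<open>The error is homogeneous in \<open>z\<close>, so one \<open>d\<close> serves all
  directions, and the error can be integrated against the second moment of the kernel. Each of the
  N^2 entries is allowed to vary by \<open>e / N\<^sup>2\<close>, and a product of two coordinates
  of \<open>z\<close> is at most the square of its norm.\<close>

lemma hess_uniformly_continuous:
  fixes f :: "'a::euclidean_space \<times> real \<Rightarrow> real"
  assumes "smooth f" "vanishes_off R f" "0 < e"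
  obtains d where "0 < d"
    "\<And>x y z t. t \<in> {0..T} \<Longrightarrow> dist y x < d \<Longrightarrow> \<bar>hess f z y t - hess f z x t\<bar> \<le> e * (norm z)\<^sup>2"
proof -
  define N where "N = real DIM('a)"
  have N: "0 < N" by (simp add: N_def)
  define g where "g b c = dir_deriv (c, 0) (dir_deriv (b, 0) f)" for b c :: 'a
  have "\<forall>b c. \<exists>d>0. \<forall>x y t. t \<in> {0..T} \<longrightarrow> dist y x < d \<longrightarrow> \<bar>g b c (y, t) - g b c (x, t)\<bar> < e / N\<^sup>2"
  proof (intro allI)
    fix b c :: 'a
    have "continuous_on UNIV (g b c)" "vanishes_off R (g b c)"
      unfolding g_def by (intro smooth_continuous_on smooth_dir_deriv vanishes_off_dir_deriv assms)+
    moreover have "0 < e / N\<^sup>2" using N assms by simp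
    ultimately show "\<exists>d>0. \<forall>x y t. t \<in> {0..T} \<longrightarrow> dist y x < d \<longrightarrow> \<bar>g b c (y, t) - g b c (x, t)\<bar> < e / N\<^sup>2"
      by (metis vanishes_off_uniformly_continuous)
  qed
  then obtain d where d: "\<And>b c. 0 < d b c"
    "\<And>b c x y t. t \<in> {0..T} \<Longrightarrow> dist y x < d b c \<Longrightarrow> \<bar>g b c (y, t) - g b c (x, t)\<bar> < e / N\<^sup>2"
    by metis
  let ?d = "Min ((\<lambda>(b, c). d b c) ` (Basis \<times> Basis))"
  show ?thesis
  proof (rule that[of ?d])
    show "0 < ?d" using d(1) by (subst Min_gr_iff) auto
    fix x y z :: 'a and t assume t: "t \<in> {0..T}" and xy: "dist y x < ?d"
    have "\<bar>(z \<bullet> b) * (z \<bullet> c) * (g b c (y, t) - g b c (x, t))\<bar> \<le> (norm z)\<^sup>2 * (e / N\<^sup>2)"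
      if "b \<in> Basis" "c \<in> Basis" for b c
    proof -
      have "?d \<le> d b c" by (rule Min_le) (use that in auto)
      then have "\<bar>g b c (y, t) - g b c (x, t)\<bar> \<le> e / N\<^sup>2"
        using d(2)[OF t, of y x b c] xy by simp
      moreover have "\<bar>(z \<bullet> b) * (z \<bullet> c)\<bar> \<le> (norm z)\<^sup>2"
        unfolding abs_mult power2_eq_square
        using that Basis_le_norm by (intro mult_mono) auto
      ultimately show ?thesis by (simp only: abs_mult) (intro mult_mono, auto)
    qed
    then have "(\<Sum>b\<in>Basis. \<Sum>c\<in>Basis. \<bar>(z \<bullet> b) * (z \<bullet> c) * (g b c (y, t) - g b c (x, t))\<bar>)
      \<le> (\<Sum>b::'a\<in>Basis. \<Sum>c::'a\<in>Basis. (norm z)\<^sup>2 * (e / N\<^sup>2))"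
      by (intro sum_mono) auto
    also have "\<dots> = e * (norm z)\<^sup>2"
      using N by (simp add: N_def power2_eq_square)
    finally have "(\<Sum>b\<in>Basis. \<Sum>c\<in>Basis. \<bar>(z \<bullet> b) * (z \<bullet> c) * (g b c (y, t) - g b c (x, t))\<bar>) \<le> e * (norm z)\<^sup>2" .
    moreover have "\<bar>hess f z y t - hess f z x t\<bar> \<le>
      (\<Sum>b\<in>Basis. \<Sum>c\<in>Basis. \<bar>(z \<bullet> b) * (z \<bullet> c) * (g b c (y, t) - g b c (x, t))\<bar>)"
      unfolding hess_def g_def[symmetric] sum_subtractf[symmetric] right_diff_distrib[symmetric]
      by (intro order_trans[OF sum_abs] sum_mono sum_abs)
    ultimately show "\<bar>hess f z y t - hess f z x t\<bar> \<le> e * (norm z)\<^sup>2" by linarith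
  qed
qed

subsection \<open>Radial kernels\<close>

lemma integral_lborel_affine:
  fixes f :: "'a::euclidean_space \<Rightarrow> real"
  assumes [measurable]: "f \<in> borel_measurable borel" and "c \<noteq> 0"
  shows "(LINT x|lborel. f x) = \<bar>c\<bar> ^ DIM('a) * (LINT x|lborel. f (t + c *\<^sub>R x))"
proof -
  have "(LINT x|lborel. f x) =
      (LINT x|density (distr lborel borel (\<lambda>x. t + c *\<^sub>R x)) (\<lambda>_. ennreal (\<bar>c\<bar> ^ DIM('a))). f x)"
    using lborel_affine[OF \<open>c \<noteq> 0\<close>, of t] by (simp add: ennreal_power)
  then show ?thesis by (simp add: integral_density integral_distr)
qed

lemma integrable_compact_support:
  fixes f :: "'a::euclidean_space \<Rightarrow> real"
  assumes "continuous_on UNIV f" "\<And>z. \<rho> < norm z \<Longrightarrow> f z = 0"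
  shows "integrable lborel f"
proof -
  have "integrable lborel (\<lambda>x. indicator (cball 0 \<rho>) x *\<^sub>R f x)"
    by (rule borel_integrable_compact) (auto intro: continuous_on_subset[OF assms(1)])
  moreover have "indicator (cball 0 \<rho>) x *\<^sub>R f x = f x" for x
    using assms(2)[of x] by (auto simp: indicator_def)
  ultimately show ?thesis by (simp only:)
qed

text \<open>The Jacobian is the product of the \<open>\<bar>c j\<bar>\<close>, hence 1. Flipping a
  single sign will cancel the mixed second moments.\<close>

lemma integral_isometry_diagonal:
  fixes g :: "'a::euclidean_space \<Rightarrow> real"
  assumes [measurable]: "g \<in> borel_measurable borel" and c: "\<And>j. \<bar>c j\<bar> = 1"
  shows "(LINT z|lborel. g (\<Sum>j\<in>Basis. (c j * (z \<bullet> j)) *\<^sub>R j)) = (LINT z|lborel. g z)"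
proof -
  have "c j \<noteq> 0" for j using c[of j] by auto
  then have "lborel = density (distr lborel borel (\<lambda>x. \<Sum>j\<in>Basis. (c j * (x \<bullet> j)) *\<^sub>R j))
      (\<lambda>_. ennreal (\<Prod>j::'a\<in>Basis. \<bar>c j\<bar>))"
    using lborel_affine_euclidean[of c 0] by simp
  then have "lborel = distr lborel borel (\<lambda>x. \<Sum>j\<in>Basis. (c j * (x \<bullet> j)) *\<^sub>R j :: 'a)"
    by (simp add: c density_1)
  then have "(LINT z|lborel. g z) = (LINT z|distr lborel borel (\<lambda>x. \<Sum>j\<in>Basis. (c j * (x \<bullet> j)) *\<^sub>R j :: 'a). g z)"
    by simp
  then show ?thesis by (simp add: integral_distr)
qed

text \<open>Stated for involutions, which covers the transpositions that identify the diagonal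
  second moments.\<close>

lemma integral_isometry_permutation:
  fixes g :: "'a::euclidean_space \<Rightarrow> real"
  assumes [measurable]: "g \<in> borel_measurable borel"
    and \<pi>: "\<And>j. j \<in> Basis \<Longrightarrow> \<pi> j \<in> Basis" "\<And>j. \<pi> (\<pi> j) = j"
  shows "(LINT z|lborel. g (\<Sum>j\<in>Basis. (z \<bullet> \<pi> j) *\<^sub>R j)) = (LINT z|lborel. g z)"
proof -
  define P where "P z = (\<Sum>j\<in>Basis. (z \<bullet> \<pi> j) *\<^sub>R j)" for z :: 'a
  have [measurable]: "P \<in> borel \<rightarrow>\<^sub>M borel" unfolding P_def by simp
  have P: "P z \<bullet> j = z \<bullet> \<pi> j" if "j \<in> Basis" for z j
    using that by (simp add: P_def)
  have bij: "bij_betw \<pi> Basis Basis"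
    by (rule bij_betwI[of \<pi> _ _ \<pi>]) (use \<pi> in auto)
  have "lborel = distr lborel borel P"
  proof (rule lborel_eqI)
    fix l u :: 'a assume le: "\<And>b. b \<in> Basis \<Longrightarrow> l \<bullet> b \<le> u \<bullet> b"
    \<comment> \<open>As \<open>\<pi>\<close> is its own inverse, the condition on coordinate
      \<open>\<pi> j\<close> of \<open>z\<close> can be read as a condition on coordinate
      \<open>j\<close> with permuted bounds: the preimage of a box is the box with permuted corners,
      and its side lengths are merely reordered.\<close>
    have "P -` box l u = box (P l) (P u)"
      unfolding box_def using \<pi> P by (auto simp: P) metis+
    then have "emeasure (distr lborel borel P) (box l u) = emeasure lborel (box (P l) (P u))"
      by (simp add: emeasure_distr)
    also have "\<dots> = (\<Prod>b\<in>Basis. (P u - P l) \<bullet> b)"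
      by (rule emeasure_lborel_box) (use le \<pi> P in auto)
    also have "(\<Prod>b\<in>Basis. (P u - P l) \<bullet> b) = (\<Prod>b\<in>Basis. (u - l) \<bullet> \<pi> b)"
      by (intro prod.cong) (auto simp: inner_diff_left P)
    also have "\<dots> = (\<Prod>b\<in>Basis. (u - l) \<bullet> b)"
      by (rule prod.reindex_bij_betw[OF bij])
    finally show "emeasure (distr lborel borel P) (box l u) = (\<Prod>b\<in>Basis. (u - l) \<bullet> b)" .
  qed simp
  then have "(LINT z|lborel. g z) = (LINT z|distr lborel borel P. g z)" by simp
  then show ?thesis by (simp add: integral_distr P_def[abs_def])
qed

text \<open>Reflections and transpositions of coordinates already suffice in place of general
  rotations: flipping coordinate \<open>b\<close> changes the sign of a mixed moment, and swapping
  two coordinates makes all diagonal moments equal, while their sum is the moment of the squared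
  norm.\<close>

lemma radial_second_moments:
  fixes J :: "'a::euclidean_space \<Rightarrow> real"
  assumes radial: "\<And>x y. norm x = norm y \<Longrightarrow> J x = J y" and J: "continuous_on UNIV J"
    and supp: "\<And>z. \<rho> < norm z \<Longrightarrow> J z = 0" and b: "b \<in> Basis" and c: "c \<in> Basis"
  shows "(LINT z|lborel. J z * ((z \<bullet> b) * (z \<bullet> c))) =
    (if b = c then (LINT z|lborel. J z * (norm z)\<^sup>2) / DIM('a) else 0)"
proof -
  have [measurable]: "J \<in> borel_measurable borel"
    using J by (rule borel_measurable_continuous_onI)
  have norm2: "(norm z)\<^sup>2 = (\<Sum>j\<in>Basis. (z \<bullet> j) * (z \<bullet> j))" for z :: 'a
    unfolding power2_norm_eq_inner by (rule euclidean_inner)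
  show ?thesis
  proof (cases "b = c")
    case False
    define s where "s j = (if j = b then - 1 else 1 :: real)" for j :: 'a
    have s: "s j * s j = 1" for j by (simp add: s_def)
    let ?P = "\<lambda>z::'a. \<Sum>j\<in>Basis. (s j * (z \<bullet> j)) *\<^sub>R j"
    have P: "?P z \<bullet> j = s j * (z \<bullet> j)" if "j \<in> Basis" for z j using that by simp
    have "(norm (?P z))\<^sup>2 = (norm z)\<^sup>2" for z
    proof -
      have "(s j * (z \<bullet> j)) * (s j * (z \<bullet> j)) = (z \<bullet> j) * (z \<bullet> j)" for j
        using s[of j] by (simp add: s_def)
      then show ?thesis unfolding norm2 by (intro sum.cong) (auto simp: P)
    qed
    then have "J (?P z) = J z" for z by (intro radial) (simp add: power2_eq_iff_nonneg)
    moreover have "s b = -1" "s c = 1" using False by (auto simp: s_def)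
    ultimately have "J (?P z) * ((?P z \<bullet> b) * (?P z \<bullet> c)) = - (J z * ((z \<bullet> b) * (z \<bullet> c)))" for z
      unfolding P[OF b] P[OF c] by simp
    moreover have "(LINT z|lborel. J (?P z) * ((?P z \<bullet> b) * (?P z \<bullet> c))) =
        (LINT z|lborel. J z * ((z \<bullet> b) * (z \<bullet> c)))"
      by (rule integral_isometry_diagonal[of "\<lambda>z. J z * ((z \<bullet> b) * (z \<bullet> c))"]) (auto simp: s_def)
    ultimately show ?thesis using False by simp
  next
    case True
    have eq: "(LINT z|lborel. J z * ((z \<bullet> j) * (z \<bullet> j))) = (LINT z|lborel. J z * ((z \<bullet> b) * (z \<bullet> b)))"
      if j: "j \<in> Basis" for j
    proof -
      define \<pi> where "\<pi> i = (if i = j then b else if i = b then j else i)" for i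
      have \<pi>: "\<And>i. i \<in> Basis \<Longrightarrow> \<pi> i \<in> Basis" "\<And>i. \<pi> (\<pi> i) = i"
        using b j by (auto simp: \<pi>_def)
      have bij: "bij_betw \<pi> Basis Basis" by (rule bij_betwI[of \<pi> _ _ \<pi>]) (use \<pi> in auto)
      let ?P = "\<lambda>z::'a. \<Sum>i\<in>Basis. (z \<bullet> \<pi> i) *\<^sub>R i"
      have P: "?P z \<bullet> i = z \<bullet> \<pi> i" if "i \<in> Basis" for z i using that by simp
      have "(norm (?P z))\<^sup>2 = (norm z)\<^sup>2" for z
      proof -
        have "(norm (?P z))\<^sup>2 = (\<Sum>i\<in>Basis. (z \<bullet> \<pi> i) * (z \<bullet> \<pi> i))"
          unfolding norm2 by (intro sum.cong) (auto simp: P)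
        also have "\<dots> = (norm z)\<^sup>2"
          unfolding norm2 by (rule sum.reindex_bij_betw[OF bij])
        finally show ?thesis .
      qed
      then have "J (?P z) = J z" for z by (intro radial) (simp add: power2_eq_iff_nonneg)
      then have "J (?P z) * ((?P z \<bullet> j) * (?P z \<bullet> j)) = J z * ((z \<bullet> b) * (z \<bullet> b))" for z
        unfolding P[OF j] by (simp add: \<pi>_def)
      moreover have "(LINT z|lborel. J (?P z) * ((?P z \<bullet> j) * (?P z \<bullet> j))) =
          (LINT z|lborel. J z * ((z \<bullet> j) * (z \<bullet> j)))"
        by (rule integral_isometry_permutation[of "\<lambda>z. J z * ((z \<bullet> j) * (z \<bullet> j))"]) (use \<pi> in auto)
      ultimately show ?thesis by simp
    qed
    have int: "integrable lborel (\<lambda>z. J z * ((z \<bullet> j) * (z \<bullet> j)))" for j :: 'a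
      by (rule integrable_compact_support[of _ \<rho>]) (auto intro!: continuous_intros J simp: supp)
    have "(LINT z|lborel. J z * (norm z)\<^sup>2) = (\<Sum>j\<in>Basis. LINT z|lborel. J z * ((z \<bullet> j) * (z \<bullet> j)))"
      unfolding norm2 sum_distrib_left using int by (subst Bochner_Integration.integral_sum) auto
    also have "\<dots> = DIM('a) * (LINT z|lborel. J z * ((z \<bullet> b) * (z \<bullet> b)))"
      by (simp add: eq)
    finally show ?thesis using True by simp
  qed
qed

section \<open>Convergence of the scaled nonlocal operator\<close>

definition nonlocal_op :: "('a::euclidean_space \<Rightarrow> real) \<Rightarrow> ('a \<times> real \<Rightarrow> real) \<Rightarrow> 'a \<Rightarrow> real \<Rightarrow> real" where
  "nonlocal_op K f x t = (LINT y|lborel. K (x - y) * (f (y, t) - f (x, t)))"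

text \<open>The jump kernel in the equation of the rescaled solution: \<open>r ^ DIM('a)\<close> is
  the Jacobian of the dilation in space, and \<open>r\<^sup>2\<close> comes from the parabolic time
  scale.\<close>

definition scaled_kernel :: "('a::euclidean_space \<Rightarrow> real) \<Rightarrow> real \<Rightarrow> 'a \<Rightarrow> real" where
  "scaled_kernel J r z = r\<^sup>2 * r ^ DIM('a) * J (r *\<^sub>R z)"

text \<open>Symmetrizing the increment cancels the first order term of the Taylor expansion.\<close>

lemma nonlocal_op_scaled_kernel:
  fixes J :: "'a::euclidean_space \<Rightarrow> real"
  assumes J: "continuous_on UNIV J" and even: "\<And>z. J (- z) = J z" and supp: "\<And>z. \<rho> < norm z \<Longrightarrow> J z = 0"
    and f: "continuous_on UNIV f" and r: "0 < r"
  shows "nonlocal_op (scaled_kernel J r) f x t =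
    (LINT z|lborel. J z * (r\<^sup>2 / 2 * (f (x + (1 / r) *\<^sub>R z, t) + f (x - (1 / r) *\<^sub>R z, t) - 2 * f (x, t))))"
proof -
  have cont: "continuous_on UNIV (\<lambda>z. J z * (f (x + c *\<^sub>R z, t) - f (x, t)))" for c
    by (intro continuous_intros J continuous_on_compose2[OF f]) auto
  then have int: "integrable lborel (\<lambda>z. J z * (f (x + c *\<^sub>R z, t) - f (x, t)))" for c
    by (rule integrable_compact_support[of _ \<rho>]) (simp add: supp)
  have meas: "(\<lambda>z. J z * (f (x + c *\<^sub>R z, t) - f (x, t))) \<in> borel_measurable borel" for c
    using cont by (rule borel_measurable_continuous_onI)
  have contK: "continuous_on UNIV (\<lambda>y. scaled_kernel J r (x - y) * (f (y, t) - f (x, t)))"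
    unfolding scaled_kernel_def
    by (intro continuous_intros continuous_on_compose2[OF J] continuous_on_compose2[OF f]) auto
  \<comment> \<open>The substitution y = x - z / r turns the scaled kernel into \<open>J z\<close>;
    the Jacobian cancels \<open>r ^ DIM('a)\<close> and leaves the factor
    \<open>r\<^sup>2\<close>.\<close>
  have 1: "nonlocal_op (scaled_kernel J r) f x t =
      r\<^sup>2 * (LINT z|lborel. J z * (f (x + (- 1 / r) *\<^sub>R z, t) - f (x, t)))"
  proof -
    have "nonlocal_op (scaled_kernel J r) f x t = \<bar>- 1 / r\<bar> ^ DIM('a) *
        (LINT z|lborel. scaled_kernel J r (x - (x + (- 1 / r) *\<^sub>R z)) * (f (x + (- 1 / r) *\<^sub>R z, t) - f (x, t)))"
      unfolding nonlocal_op_def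
      by (rule integral_lborel_affine[OF borel_measurable_continuous_onI[OF contK]]) (use r in simp)
    also have "\<dots> = \<bar>- 1 / r\<bar> ^ DIM('a) *
        (LINT z|lborel. (r\<^sup>2 * r ^ DIM('a)) * (J z * (f (x + (- 1 / r) *\<^sub>R z, t) - f (x, t))))"
      using r by (simp add: scaled_kernel_def mult.assoc)
    also have "\<dots> = r\<^sup>2 * (LINT z|lborel. J z * (f (x + (- 1 / r) *\<^sub>R z, t) - f (x, t)))"
      unfolding integral_mult_right_zero using r by (simp add: power_divide)
    finally show ?thesis .
  qed
  have 2: "(LINT z|lborel. J z * (f (x + (- 1 / r) *\<^sub>R z, t) - f (x, t))) =
      (LINT z|lborel. J z * (f (x + (1 / r) *\<^sub>R z, t) - f (x, t)))"
    using integral_lborel_affine[OF meas[of "- 1 / r"], of "- 1" 0] by (simp add: even)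
  have "nonlocal_op (scaled_kernel J r) f x t =
      r\<^sup>2 / 2 * (LINT z|lborel. J z * (f (x + (1 / r) *\<^sub>R z, t) - f (x, t))) +
      r\<^sup>2 / 2 * (LINT z|lborel. J z * (f (x + (- 1 / r) *\<^sub>R z, t) - f (x, t)))"
    using 1 2 by simp
  also have "\<dots> = (LINT z|lborel. r\<^sup>2 / 2 * (J z * (f (x + (1 / r) *\<^sub>R z, t) - f (x, t))) +
      r\<^sup>2 / 2 * (J z * (f (x + (- 1 / r) *\<^sub>R z, t) - f (x, t))))"
    using int[of "1 / r"] int[of "- 1 / r"] by (subst Bochner_Integration.integral_add) auto
  finally show ?thesis by (simp add: algebra_simps)
qed

text \<open>Rescaled symmetric increments are averages of Hessian values at distance less than
  \<open>\<rho> / r\<close> from \<open>x\<close>, because \<open>J\<close> only sees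
  \<open>norm z \<le> \<rho>\<close>. Uniform continuity replaces them by the value at
  \<open>x\<close>, and the second moments of \<open>J\<close> turn the Hessian form into the
  Laplacian. The estimate is uniform over all of space since \<open>f\<close> has compact support
  there.\<close>

lemma nonlocal_op_tendsto_laplacian:
  fixes J :: "'a::euclidean_space \<Rightarrow> real"
  assumes radial: "\<And>x y. norm x = norm y \<Longrightarrow> J x = J y" and J: "continuous_on UNIV J"
    and J0: "\<And>z. 0 \<le> J z"
    and supp: "\<And>z. \<rho> < norm z \<Longrightarrow> J z = 0" and \<rho>: "0 < \<rho>"
    and f: "smooth f" "vanishes_off R f" and e: "0 < e"
  shows "\<forall>\<^sub>F r in at_top. \<forall>x. \<forall>t\<in>{0..T}.
    \<bar>nonlocal_op (scaled_kernel J r) f x t - diffusivity J * space_laplacian f (x, t)\<bar> \<le> e"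
proof -
  define m where "m = (LINT z|lborel. J z * (norm z)\<^sup>2)"
  have m: "0 \<le> m" unfolding m_def using J0 by (intro Bochner_Integration.integral_nonneg) auto
  have m_int: "integrable lborel (\<lambda>z. J z * (norm z)\<^sup>2)"
    by (rule integrable_compact_support[of _ \<rho>]) (auto intro!: continuous_intros J simp: supp)
  \<comment> \<open>The final error is \<open>e' / 2\<close> times the second moment
    \<open>m\<close>; dividing by \<open>m + 1\<close> makes this at most \<open>e\<close> without
    asking that \<open>m\<close> be nonzero.\<close>
  define e' where "e' = 2 * e / (m + 1)"
  have e': "0 < e'" using e m by (simp add: e'_def)
  have em: "e' / 2 * m \<le> e"
    using e m by (simp add: e'_def field_simps)
  obtain d where d: "0 < d" "\<And>x y z t. t \<in> {0..T} \<Longrightarrow> dist y x < d \<Longrightarrow>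
      \<bar>hess f z y t - hess f z x t\<bar> \<le> e' * (norm z)\<^sup>2"
    using hess_uniformly_continuous[OF f e'] by metis
  \<comment> \<open>Mixed moments drop out and every diagonal one equals \<open>m / DIM('a)\<close>;
    together with the factor 1/2 from Taylor's formula this is exactly the constant in
    \<open>diffusivity\<close>.\<close>
  have lap: "(LINT z|lborel. J z * (hess f z x t / 2)) = diffusivity J * space_laplacian f (x, t)"
    and lap_int: "integrable lborel (\<lambda>z. J z * (hess f z x t / 2))" for x t
  proof -
    define D where "D b c = dir_deriv (c, 0) (dir_deriv (b, 0) f) (x, t) / 2" for b c :: 'a
    have eq: "J z * (hess f z x t / 2) = (\<Sum>b\<in>Basis. \<Sum>c\<in>Basis. D b c * (J z * ((z \<bullet> b) * (z \<bullet> c))))" for z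
      unfolding hess_def D_def sum_divide_distrib sum_distrib_left by (simp add: algebra_simps)
    have int: "integrable lborel (\<lambda>z. J z * ((z \<bullet> b) * (z \<bullet> c)))" for b c :: 'a
      by (rule integrable_compact_support[of _ \<rho>]) (auto intro!: continuous_intros J simp: supp)
    show "integrable lborel (\<lambda>z. J z * (hess f z x t / 2))"
      unfolding eq by (intro Bochner_Integration.integrable_sum integrable_mult_right int)
    have "(LINT z|lborel. J z * (hess f z x t / 2)) =
        (\<Sum>b\<in>Basis. \<Sum>c\<in>Basis. D b c * (LINT z|lborel. J z * ((z \<bullet> b) * (z \<bullet> c))))"
      unfolding eq by (simp add: int Bochner_Integration.integrable_sum)
    also have "\<dots> = (\<Sum>b\<in>Basis. \<Sum>c\<in>Basis. D b c * (if b = c then m / DIM('a) else 0))"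
      unfolding m_def
      by (intro sum.cong refl arg_cong2[where f = "(*)"] radial_second_moments[OF radial J supp]) auto
    also have "\<dots> = (\<Sum>b\<in>Basis. D b b * (m / DIM('a)))"
      by (simp add: if_distrib[of "\<lambda>x. _ * x"] cong: if_cong)
    also have "\<dots> = diffusivity J * space_laplacian f (x, t)"
      unfolding diffusivity_def m_def[symmetric] space_laplacian_def D_def sum_distrib_left
      by (intro sum.cong) (auto simp: field_simps)
    finally show "(LINT z|lborel. J z * (hess f z x t / 2)) = diffusivity J * space_laplacian f (x, t)" .
  qed
  have f_cont: "continuous_on UNIV f" by (rule smooth_continuous_on[OF f(1)])
  have "\<bar>nonlocal_op (scaled_kernel J r) f x t - diffusivity J * space_laplacian f (x, t)\<bar> \<le> e"
    if r: "0 < r" "\<rho> / d < r" and t: "t \<in> {0..T}" for r x t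
  proof -
    define q where "q z = r\<^sup>2 / 2 * (f (x + (1 / r) *\<^sub>R z, t) + f (x - (1 / r) *\<^sub>R z, t) - 2 * f (x, t))" for z
    have "continuous_on UNIV q" unfolding q_def
      by (intro continuous_intros continuous_on_compose2[OF f_cont]) auto
    then have q_int: "integrable lborel (\<lambda>z. J z * q z)"
      by (intro integrable_compact_support[of _ \<rho>] continuous_intros J) (auto simp: supp)
    \<comment> \<open>Below, \<open>q z\<close> is a quarter of the sum of two Hessian values, each
      within \<open>g\<close> of the value \<open>c\<close> at \<open>x\<close>, and is to be
      compared with \<open>c / 2\<close>.\<close>
    have avg: "\<bar>(a + b) / 4 - c / 2\<bar> \<le> g / 2" if "\<bar>a - c\<bar> \<le> g" "\<bar>b - c\<bar> \<le> g" for a b c g :: real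
    proof -
      have le: "\<bar>a + b - 2 * c\<bar> \<le> 2 * g" using that by linarith
      have "(a + b) / 4 - c / 2 = (a + b - 2 * c) / 4" by (simp add: field_simps)
      then have "\<bar>(a + b) / 4 - c / 2\<bar> = \<bar>a + b - 2 * c\<bar> / 4" by (simp only: abs_divide abs_numeral)
      also have "\<dots> \<le> 2 * g / 4" using le by (rule divide_right_mono) simp
      finally show ?thesis by simp
    qed
    have even: "J (- z) = J z" for z by (rule radial) simp
    have bound: "\<bar>J z * q z - J z * (hess f z x t / 2)\<bar> \<le> e' / 2 * (J z * (norm z)\<^sup>2)" for z
    proof (cases "\<rho> < norm z")
      case False
      obtain \<xi> where \<xi>: "0 < \<xi>" "\<xi> < 1 / r" and eq: "f (x + (1 / r) *\<^sub>R z, t) + f (x - (1 / r) *\<^sub>R z, t) - 2 * f (x, t) =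
          (1 / r)\<^sup>2 / 2 * (hess f z (x + \<xi> *\<^sub>R z) t + hess f z (x - \<xi> *\<^sub>R z) t)"
        using second_difference[OF f(1), of "1 / r" x z t] r by auto
      have q: "q z = (hess f z (x + \<xi> *\<^sub>R z) t + hess f z (x - \<xi> *\<^sub>R z) t) / 4"
        unfolding q_def eq using r by (simp add: field_simps power2_eq_square)
      \<comment> \<open>Both evaluation points are within \<open>\<rho> / r\<close> of
        \<open>x\<close>, and \<open>r\<close> was chosen to make this smaller than
        \<open>d\<close>.\<close>
      have "\<xi> * norm z \<le> 1 / r * \<rho>" using False \<xi> r by (intro mult_mono) auto
      also have "\<dots> < d" using r d(1) by (simp add: field_simps)
      finally have "\<xi> * norm z < d" .
      then have "\<bar>hess f z (x + \<xi> *\<^sub>R z) t - hess f z x t\<bar> \<le> e' * (norm z)\<^sup>2"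
        "\<bar>hess f z (x - \<xi> *\<^sub>R z) t - hess f z x t\<bar> \<le> e' * (norm z)\<^sup>2"
        using \<xi> by (intro d(2)[OF t]; simp add: dist_norm)+
      then have "\<bar>q z - hess f z x t / 2\<bar> \<le> (e' * (norm z)\<^sup>2) / 2" unfolding q by (rule avg)
      then have "J z * \<bar>q z - hess f z x t / 2\<bar> \<le> J z * ((e' * (norm z)\<^sup>2) / 2)"
        using J0 by (intro mult_left_mono) auto
      moreover have "\<bar>J z * q z - J z * (hess f z x t / 2)\<bar> = J z * \<bar>q z - hess f z x t / 2\<bar>"
        by (simp only: right_diff_distrib[symmetric] abs_mult abs_of_nonneg[OF J0])
      ultimately show ?thesis by (simp only: mult_ac times_divide_eq_right times_divide_eq_left)
    qed (simp add: supp)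
    have nl: "nonlocal_op (scaled_kernel J r) f x t = (LINT z|lborel. J z * q z)"
      unfolding q_def by (rule nonlocal_op_scaled_kernel[OF J even supp f_cont r(1)])
    have "nonlocal_op (scaled_kernel J r) f x t - diffusivity J * space_laplacian f (x, t) =
        (LINT z|lborel. J z * q z - J z * (hess f z x t / 2))"
      unfolding nl lap[symmetric]
      using q_int lap_int[of x t] by (rule Bochner_Integration.integral_diff[symmetric])
    also have "\<bar>\<dots>\<bar> \<le> (LINT z|lborel. \<bar>J z * q z - J z * (hess f z x t / 2)\<bar>)"
      by (rule integral_abs_bound)
    also have "\<dots> \<le> (LINT z|lborel. e' / 2 * (J z * (norm z)\<^sup>2))"
      using q_int lap_int[of x t] m_int bound
      by (intro integral_mono integrable_abs Bochner_Integration.integrable_diff integrable_mult_right) auto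
    also have "\<dots> = e' / 2 * m" by (simp add: m_def)
    finally show ?thesis using em by simp
  qed
  then show ?thesis
    by (intro eventually_mono[OF eventually_conj[OF eventually_gt_at_top[of 0] eventually_gt_at_top[of "\<rho> / d"]]]) auto
qed

subsection \<open>Weak formulation\<close>

lemma set_integrable_bounded:
  fixes g :: "'b::euclidean_space \<Rightarrow> real"
  assumes "g \<in> borel_measurable borel" "A \<in> sets borel" "bounded A" "\<And>z. z \<in> A \<Longrightarrow> \<bar>g z\<bar> \<le> C"
  shows "set_integrable lborel A g"
proof -
  have "integrable lborel (\<lambda>z. indicator A z *\<^sub>R g z)"
    by (rule integrableI_bounded_set_indicator[where B = C])
       (use assms emeasure_bounded_finite[OF assms(3)] in auto)
  then show ?thesis by (simp add: set_integrable_def)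
qed

lemma integrable_bounded_support:
  fixes g :: "'b::euclidean_space \<Rightarrow> real"
  assumes "g \<in> borel_measurable borel" "A \<in> sets borel" "bounded A" "\<And>z. z \<in> A \<Longrightarrow> \<bar>g z\<bar> \<le> C"
    "\<And>z. z \<notin> A \<Longrightarrow> g z = 0"
  shows "integrable lborel g"
proof -
  have "set_integrable lborel A g" using assms(1-4) by (rule set_integrable_bounded)
  moreover have "(\<lambda>z. indicator A z *\<^sub>R g z) = g"
    using assms(5) by (auto simp: indicator_def fun_eq_iff)
  ultimately show ?thesis by (simp add: set_integrable_def)
qed

text \<open>
  Solutions with initial datum \<open>w (\<cdot>, 0)\<close>, modified on a null set in space so that everything but
  the equation holds at every point. The kernel is arbitrary and the absorption has a
  coefficient, so the notion is stable under the rescaling.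
\<close>

definition regular_solution ::
    "('a::euclidean_space \<Rightarrow> real) \<Rightarrow> real \<Rightarrow> real \<Rightarrow> ('a \<times> real \<Rightarrow> real) \<Rightarrow> bool" where
  "regular_solution K \<mu> p w \<longleftrightarrow>
     w \<in> borel_measurable borel \<and> (\<forall>z. 0 \<le> w z) \<and>
     (\<forall>T. \<exists>M. \<forall>x. \<forall>t\<le>T. w (x, t) \<le> M) \<and> (\<forall>x. continuous_on {0..} (\<lambda>t. w (x, t))) \<and>
     (AE x in lborel. \<forall>t>0. ((\<lambda>t. w (x, t)) has_real_derivative
        nonlocal_op K w x t - \<mu> * w (x, t) powr p) (at t))"

section \<open>Symmetric jump kernels of bounded range\<close>

text \<open>Each \<open>scaled_kernel J r\<close> is an instance, with range
  \<open>\<rho> / r\<close>.\<close>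

locale bounded_kernel =
  fixes K :: "'a::euclidean_space \<Rightarrow> real" and \<rho> :: real
  assumes K_cont: "continuous_on UNIV K" and K_even: "\<And>z. K (- z) = K z"
    and K_supp: "\<And>z. \<rho> < norm z \<Longrightarrow> K z = 0" and \<rho>: "0 \<le> \<rho>"
begin

lemma K_measurable [measurable]: "K \<in> borel_measurable borel"
  using K_cont by (rule borel_measurable_continuous_onI)

lemma K_translate_integrable: "integrable lborel (\<lambda>y. K (x - y))"
proof (rule integrable_compact_support[where \<rho> = "norm x + \<rho>"])
  fix y :: 'a assume "norm x + \<rho> < norm y"
  moreover have "norm y - norm x \<le> norm (x - y)" by (metis norm_minus_commute norm_triangle_ineq2)
  ultimately show "K (x - y) = 0" by (intro K_supp) linarith
qed (auto intro!: continuous_intros continuous_on_compose2[OF K_cont])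

lemma K_translate_abs_integral: "(LINT y|lborel. \<bar>K (x - y)\<bar>) = (LINT z|lborel. \<bar>K z\<bar>)"
  using integral_lborel_affine[of "\<lambda>y. \<bar>K (x - y)\<bar>" "- 1" x] by simp

lemma nonlocal_op_measurable [measurable]:
  assumes [measurable]: "w \<in> borel_measurable borel"
  shows "(\<lambda>z. nonlocal_op K w (fst z) (snd z)) \<in> borel_measurable borel"
proof -
  have [measurable]: "w \<in> borel_measurable (borel \<Otimes>\<^sub>M borel)"
    by (simp add: borel_prod)
  have "(\<lambda>z. nonlocal_op K w (fst z) (snd z)) \<in> borel_measurable (borel \<Otimes>\<^sub>M borel)"
    unfolding nonlocal_op_def by measurable
  then show ?thesis by (simp add: borel_prod)
qed

text \<open>A qualitative bound: for \<open>scaled_kernel J r\<close> the right-hand side grows like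
  r^2. It provides integrability for one kernel at a time, whereas bounds uniform in
  \<open>r\<close> come from the convergence to the Laplacian.\<close>

lemma abs_nonlocal_op_le:
  assumes [measurable]: "w \<in> borel_measurable borel" and w: "\<And>x. \<bar>w (x, t)\<bar> \<le> M"
  shows "\<bar>nonlocal_op K w x t\<bar> \<le> 2 * M * (LINT z|lborel. \<bar>K z\<bar>)"
proof -
  have le: "\<bar>K (x - y) * (w (y, t) - w (x, t))\<bar> \<le> 2 * M * \<bar>K (x - y)\<bar>" for y
  proof -
    have "\<bar>w (y, t) - w (x, t)\<bar> \<le> 2 * M" using w[of x] w[of y] by linarith
    then show ?thesis unfolding abs_mult by (subst mult.commute) (rule mult_right_mono, auto)
  qed
  have int: "integrable lborel (\<lambda>y. 2 * M * \<bar>K (x - y)\<bar>)"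
    using K_translate_integrable by (intro integrable_mult_right integrable_abs)
  have "\<bar>nonlocal_op K w x t\<bar> \<le> (LINT y|lborel. \<bar>K (x - y) * (w (y, t) - w (x, t))\<bar>)"
    unfolding nonlocal_op_def by (rule integral_abs_bound)
  also have "\<dots> \<le> (LINT y|lborel. 2 * M * \<bar>K (x - y)\<bar>)"
  proof (intro integral_mono Bochner_Integration.integrable_bound[OF int] int le)
    show "AE y in lborel. norm \<bar>K (x - y) * (w (y, t) - w (x, t))\<bar> \<le> norm (2 * M * \<bar>K (x - y)\<bar>)"
      unfolding real_norm_def abs_idempotent by (intro AE_I2 order_trans[OF le abs_ge_self])
  qed measurable
  finally show ?thesis by (simp add: K_translate_abs_integral)
qed

text \<open>Both sides split into a term \<open>F\<close> that couples \<open>x\<close> and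
  \<open>y\<close> and a diagonal term \<open>G\<close>. The diagonal terms coincide, and evenness
  of \<open>K\<close> with Fubini's theorem matches the others. As \<open>w\<close> is only bounded,
  integrability on the product rests on the compact support of \<open>f\<close> and the bounded
  range of \<open>K\<close>.\<close>

lemma nonlocal_op_symmetric:
  assumes [measurable]: "w \<in> borel_measurable borel" and w: "\<And>x. \<bar>w (x, t)\<bar> \<le> M"
    and f: "continuous_on UNIV f" "vanishes_off R f" and t: "0 \<le> t"
  shows "(LINT x|lborel. f (x, t) * nonlocal_op K w x t) = (LINT x|lborel. w (x, t) * nonlocal_op K f x t)"
proof -
  have [measurable]: "f \<in> borel_measurable borel"
    using f(1) by (rule borel_measurable_continuous_onI)
  obtain Cf where Cf: "\<And>x. \<bar>f (x, t)\<bar> \<le> Cf"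
    using vanishes_off_bounded[OF f, of t] t by (metis atLeastAtMost_iff order_refl)
  have f0: "f (x, t) = 0" if "R < norm x" for x using f(2) that by (auto simp: vanishes_off_def)
  obtain CK where CK: "\<And>z. \<bar>K z\<bar> \<le> CK"
  proof -
    have "bounded (K ` cball 0 \<rho>)"
      by (intro compact_imp_bounded compact_continuous_image continuous_on_subset[OF K_cont]) auto
    then obtain C where C: "\<forall>z \<in> cball 0 \<rho>. \<bar>K z\<bar> \<le> C" unfolding bounded_iff by auto
    have "\<bar>K z\<bar> \<le> max C 0" for z
      using C K_supp[of z] by (cases "norm z \<le> \<rho>") (auto simp: le_max_iff_disj)
    then show ?thesis by (rule that)
  qed
  have nn: "0 \<le> CK" "0 \<le> Cf" "0 \<le> M"
    using CK[of 0] Cf[of 0] w[of 0] by linarith+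
  define F where "F x y = K (x - y) * f (x, t) * w (y, t)" for x y
  define G where "G x y = K (x - y) * (f (x, t) * w (x, t))" for x y
  have far: "K (x - y) = 0" if "norm x \<le> R" "R + \<rho> < norm y" for x y
  proof (rule K_supp)
    have "norm y - norm x \<le> norm (x - y)" by (metis norm_minus_commute norm_triangle_ineq2)
    then show "\<rho> < norm (x - y)" using that by linarith
  qed
  have bd: "\<bar>K a * f (b, t) * w (c, t)\<bar> \<le> CK * Cf * M" for a b c
    unfolding abs_mult using CK Cf w nn by (intro mult_mono) auto
  \<comment> \<open>A nonzero value needs \<open>x\<close> in the support of \<open>f\<close> and
    \<open>y\<close> within distance \<open>\<rho>\<close> of \<open>x\<close>.\<close>
  have zero: "F x y = 0" "G x y = 0" if "(x, y) \<notin> cball 0 R \<times> cball 0 (R + \<rho>)" for x y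
    using that far[of x y] f0[of x] by (cases "norm x \<le> R"; simp add: F_def G_def not_le)+
  have F_int: "integrable (lborel \<Otimes>\<^sub>M lborel) (\<lambda>(x, y). F x y)"
    unfolding lborel_prod
  proof (rule integrable_bounded_support)
    show "(\<lambda>(x, y). F x y) \<in> borel_measurable borel"
      unfolding F_def by (simp add: borel_prod[symmetric])
    show "bounded (cball 0 R \<times> cball 0 (R + \<rho>))" "cball 0 R \<times> cball 0 (R + \<rho>) \<in> sets borel"
      by (auto intro!: bounded_Times borel_closed closed_Times)
    fix z :: "'a \<times> 'a"
    show "\<bar>case z of (x, y) \<Rightarrow> F x y\<bar> \<le> CK * Cf * M"
      using bd by (cases z) (simp add: F_def mult.assoc)
    show "(case z of (x, y) \<Rightarrow> F x y) = 0" if "z \<notin> cball 0 R \<times> cball 0 (R + \<rho>)"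
      using zero that by (cases z) (simp only: split)
  qed
  have G_int: "integrable (lborel \<Otimes>\<^sub>M lborel) (\<lambda>(x, y). G x y)"
    unfolding lborel_prod
  proof (rule integrable_bounded_support)
    show "(\<lambda>(x, y). G x y) \<in> borel_measurable borel"
      unfolding G_def by (simp add: borel_prod[symmetric])
    show "bounded (cball 0 R \<times> cball 0 (R + \<rho>))" "cball 0 R \<times> cball 0 (R + \<rho>) \<in> sets borel"
      by (auto intro!: bounded_Times borel_closed closed_Times)
    fix z :: "'a \<times> 'a"
    show "\<bar>case z of (x, y) \<Rightarrow> G x y\<bar> \<le> CK * Cf * M"
      using bd by (cases z) (simp add: G_def mult.assoc)
    show "(case z of (x, y) \<Rightarrow> G x y) = 0" if "z \<notin> cball 0 R \<times> cball 0 (R + \<rho>)"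
      using zero that by (cases z) (simp only: split)
  qed
  have Kw_int: "integrable lborel (\<lambda>y. K (x - y) * w (y, t))" for x
  proof (rule Bochner_Integration.integrable_bound)
    show "integrable lborel (\<lambda>y. M * K (x - y))"
      using K_translate_integrable by (rule integrable_mult_right)
    show "AE y in lborel. norm (K (x - y) * w (y, t)) \<le> norm (M * K (x - y))"
      using w nn by (auto simp: abs_mult intro!: AE_I2 mult_mono[THEN order_trans[OF eq_refl[OF mult.commute]]])
  qed simp
  have Kf_int: "integrable lborel (\<lambda>y. K (x - y) * f (y, t))" for x
    by (rule integrable_compact_support[where \<rho> = R])
       (auto intro!: continuous_intros continuous_on_compose2[OF K_cont] continuous_on_compose2[OF f(1)] simp: f0)
  have "f (x, t) * nonlocal_op K w x t = (LINT y|lborel. F x y) - (LINT y|lborel. G x y)" for x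
  proof -
    have "f (x, t) * nonlocal_op K w x t = (LINT y|lborel. f (x, t) * (K (x - y) * w (y, t)) - f (x, t) * w (x, t) * K (x - y))"
      unfolding nonlocal_op_def integral_mult_right_zero[symmetric] by (simp add: algebra_simps)
    also have "\<dots> = (LINT y|lborel. f (x, t) * (K (x - y) * w (y, t))) - (LINT y|lborel. f (x, t) * w (x, t) * K (x - y))"
      by (intro Bochner_Integration.integral_diff integrable_mult_right Kw_int K_translate_integrable)
    finally show ?thesis by (simp add: F_def G_def mult_ac)
  qed
  then have "(LINT x|lborel. f (x, t) * nonlocal_op K w x t) =
      (LINT x|lborel. LINT y|lborel. F x y) - (LINT x|lborel. LINT y|lborel. G x y)"
    using lborel_pair.integrable_fst[OF F_int] lborel_pair.integrable_fst[OF G_int] by simp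
  moreover have "w (x, t) * nonlocal_op K f x t = (LINT y|lborel. F y x) - (LINT y|lborel. G x y)" for x
  proof -
    have "w (x, t) * nonlocal_op K f x t = (LINT y|lborel. w (x, t) * (K (x - y) * f (y, t)) - f (x, t) * w (x, t) * K (x - y))"
      unfolding nonlocal_op_def integral_mult_right_zero[symmetric] by (simp add: algebra_simps)
    also have "\<dots> = (LINT y|lborel. w (x, t) * (K (x - y) * f (y, t))) - (LINT y|lborel. f (x, t) * w (x, t) * K (x - y))"
      by (intro Bochner_Integration.integral_diff integrable_mult_right Kf_int K_translate_integrable)
    moreover have "K (y - x) = K (x - y)" for y using K_even[of "x - y"] by simp
    ultimately show ?thesis by (simp add: F_def G_def mult_ac)
  qed
  then have "(LINT x|lborel. w (x, t) * nonlocal_op K f x t) =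
      (LINT x|lborel. LINT y|lborel. F y x) - (LINT x|lborel. LINT y|lborel. G x y)"
    using lborel_pair.integrable_snd[OF F_int] lborel_pair.integrable_fst[OF G_int] by simp
  moreover have "(LINT x|lborel. LINT y|lborel. F y x) = (LINT x|lborel. LINT y|lborel. F x y)"
    by (rule lborel_pair.Fubini_integral[OF F_int])
  ultimately show ?thesis by simp
qed

text \<open>Jumps have length at most \<open>\<rho>\<close>, so the operator enlarges the support by
  no more than that.\<close>

lemma nonlocal_op_support:
  assumes "vanishes_off R f" "R + \<rho> < norm x" shows "nonlocal_op K f x t = 0"
proof -
  have "K (x - y) * (f (y, t) - f (x, t)) = 0" for y
  proof (cases "norm y \<le> R")
    case True
    then have "\<rho> < norm (x - y)" using assms norm_triangle_sub[of x y] by linarith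
    then show ?thesis by (simp add: K_supp)
  next
    case False
    then show ?thesis using assms \<rho> by (auto simp: vanishes_off_def)
  qed
  then show ?thesis by (simp only: nonlocal_op_def Bochner_Integration.integral_zero)
qed

text \<open>For almost every \<open>x\<close> the product of \<open>w\<close> and \<open>f\<close>
  is differentiated and integrated in time; the operator then changes sides at each fixed time,
  between two applications of Fubini's theorem. Since \<open>f\<close> may be nonzero at times 0 and
  \<open>T\<close>, boundary terms remain; the one at 0 carries the initial datum.\<close>

lemma weak_formulation:
  assumes w: "regular_solution K \<mu> p w" and p: "0 < p" and f: "smooth f" "vanishes_off R f" and T: "0 \<le> T"
  defines "S \<equiv> cball 0 (R + \<rho>)"
  shows "(LINT x|lborel. w (x, T) * f (x, T)) - (LINT x|lborel. w (x, 0) * f (x, 0)) =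
    (LINT z:S \<times> {0<..<T}|lborel.
      w z * (time_deriv f z + nonlocal_op K f (fst z) (snd z)) - \<mu> * w z powr p * f z)"
proof -
  have w_meas [measurable]: "w \<in> borel_measurable borel" and w0: "\<And>z. 0 \<le> w z"
    and w_cont: "\<And>x. continuous_on {0..} (\<lambda>t. w (x, t))"
    and w_ode: "AE x in lborel. \<forall>t>0. ((\<lambda>t. w (x, t)) has_real_derivative
        nonlocal_op K w x t - \<mu> * w (x, t) powr p) (at t)"
    using w unfolding regular_solution_def by auto
  obtain M where M: "\<And>x t. t \<le> T \<Longrightarrow> w (x, t) \<le> M"
    using w unfolding regular_solution_def by metis
  have f_cont: "continuous_on UNIV f" by (rule smooth_continuous_on[OF f(1)])
  have ft_cont: "continuous_on UNIV (time_deriv f)"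
    unfolding time_deriv_def by (intro smooth_continuous_on smooth_dir_deriv f)
  have ft_off: "vanishes_off R (time_deriv f)"
    unfolding time_deriv_def by (intro vanishes_off_dir_deriv f)
  have [measurable]: "f \<in> borel_measurable borel" "time_deriv f \<in> borel_measurable borel"
    using f_cont ft_cont by (auto intro: borel_measurable_continuous_onI)
  obtain Cf where Cf: "0 \<le> Cf" "\<And>x t. t \<in> {0..T} \<Longrightarrow> \<bar>f (x, t)\<bar> \<le> Cf"
    using vanishes_off_bounded[OF f_cont f(2)] by metis
  obtain Ct where Ct: "0 \<le> Ct" "\<And>x t. t \<in> {0..T} \<Longrightarrow> \<bar>time_deriv f (x, t)\<bar> \<le> Ct"
    using vanishes_off_bounded[OF ft_cont ft_off] by metis
  define CK where "CK = (LINT z|lborel. \<bar>K z\<bar>)"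
  have CK: "0 \<le> CK" unfolding CK_def by simp
  have M0: "0 \<le> M" using w0[of "(0, T)"] M[of T 0] by linarith
  have wM: "\<bar>w (x, t)\<bar> \<le> M" if "t \<le> T" for x t using w0 M that by simp
  have wp: "\<bar>w (x, t) powr p\<bar> \<le> M powr p" if "t \<le> T" for x t
    using w0 M that p by (simp add: powr_mono2)
  \<comment> \<open>\<open>E\<close> is the time derivative of the product of \<open>w\<close> and
    \<open>f\<close>, and \<open>E'\<close> is the integrand with the operator moved to
    \<open>f\<close>. They differ pointwise and agree only after integration over \<open>x\<close>,
    which is why the order of integration is exchanged in between.\<close>
  define E where "E z = f z * (nonlocal_op K w (fst z) (snd z) - \<mu> * w z powr p) + w z * time_deriv f z" for z
  define E' where "E' z = w z * (time_deriv f z + nonlocal_op K f (fst z) (snd z)) - \<mu> * w z powr p * f z" for z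
  have E_meas [measurable]: "E \<in> borel_measurable borel" "E' \<in> borel_measurable borel"
    unfolding E_def[abs_def] E'_def[abs_def] by measurable
  have E_bd: "\<bar>E (x, t)\<bar> \<le> Cf * (2 * M * CK + \<bar>\<mu>\<bar> * M powr p) + M * Ct" if t: "t \<in> {0..T}" for x t
  proof -
    have "\<bar>nonlocal_op K w x t\<bar> \<le> 2 * M * CK"
      unfolding CK_def using t wM by (intro abs_nonlocal_op_le w_meas) auto
    moreover have "\<bar>\<mu> * w (x, t) powr p\<bar> \<le> \<bar>\<mu>\<bar> * M powr p"
      unfolding abs_mult using wp t by (intro mult_left_mono) auto
    ultimately have "\<bar>nonlocal_op K w x t - \<mu> * w (x, t) powr p\<bar> \<le> 2 * M * CK + \<bar>\<mu>\<bar> * M powr p"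
      by linarith
    then have "\<bar>f (x, t) * (nonlocal_op K w x t - \<mu> * w (x, t) powr p)\<bar> \<le> Cf * (2 * M * CK + \<bar>\<mu>\<bar> * M powr p)"
      unfolding abs_mult using Cf t by (intro mult_mono) auto
    moreover have "\<bar>w (x, t) * time_deriv f (x, t)\<bar> \<le> M * Ct"
      unfolding abs_mult using Ct t wM M0 by (intro mult_mono) auto
    ultimately show ?thesis unfolding E_def fst_conv snd_conv by linarith
  qed
  have E'_bd: "\<bar>E' (x, t)\<bar> \<le> M * (Ct + 2 * Cf * CK) + \<bar>\<mu>\<bar> * M powr p * Cf" if t: "t \<in> {0..T}" for x t
  proof -
    have "\<bar>nonlocal_op K f x t\<bar> \<le> 2 * Cf * CK"
      unfolding CK_def using t Cf by (intro abs_nonlocal_op_le) auto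
    then have "\<bar>time_deriv f (x, t) + nonlocal_op K f x t\<bar> \<le> Ct + 2 * Cf * CK"
      using Ct(2)[OF t, of x] by linarith
    then have "\<bar>w (x, t) * (time_deriv f (x, t) + nonlocal_op K f x t)\<bar> \<le> M * (Ct + 2 * Cf * CK)"
      unfolding abs_mult using t wM M0 by (intro mult_mono) auto
    moreover have "\<bar>\<mu> * w (x, t) powr p * f (x, t)\<bar> \<le> \<bar>\<mu>\<bar> * M powr p * Cf"
      unfolding abs_mult using wp t Cf M0 by (intro mult_mono) auto
    ultimately show ?thesis unfolding E'_def fst_conv snd_conv by linarith
  qed
  have E_off: "E (x, t) = 0" if "x \<notin> cball 0 R" for x t
    using that f(2) ft_off by (simp add: E_def vanishes_off_def)
  have E'_off: "E' (x, t) = 0" if "x \<notin> S" for x t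
  proof -
    have "R + \<rho> < norm x" using that by (simp add: S_def not_le)
    moreover then have "x \<notin> cball 0 R" using \<rho> by auto
    ultimately show ?thesis
      using f(2) ft_off nonlocal_op_support[OF f(2)] by (simp add: E'_def vanishes_off_def)
  qed
  have F_meas: "(\<lambda>(x, t). indicator {0<..<T} t * g (x, t)) \<in> borel_measurable borel"
    if [measurable]: "g \<in> borel_measurable borel" for g :: "'a \<times> real \<Rightarrow> real"
    by (simp add: borel_prod[symmetric])
  have E_int: "integrable (lborel \<Otimes>\<^sub>M lborel) (\<lambda>(x, t). indicator {0<..<T} t * E (x, t))"
    unfolding lborel_prod
  proof (rule integrable_bounded_support[OF F_meas[OF E_meas(1)]])
    show "bounded (cball 0 R \<times> {0..T})" "cball 0 R \<times> {0..T} \<in> sets borel"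
      by (auto intro!: bounded_Times borel_closed closed_Times simp: S_def)
    fix z
    show "\<bar>case z of (x, t) \<Rightarrow> indicator {0<..<T} t * E (x, t)\<bar> \<le> Cf * (2 * M * CK + \<bar>\<mu>\<bar> * M powr p) + M * Ct"
      if "z \<in> cball 0 R \<times> {0..T}"
    proof -
      have "\<bar>case z of (x, t) \<Rightarrow> indicator {0<..<T} t * E (x, t)\<bar> \<le> \<bar>E z\<bar>"
        by (cases z) (auto simp: indicator_def)
      then show ?thesis using that E_bd[of "snd z" "fst z"] by (cases z) auto
    qed
    show "(case z of (x, t) \<Rightarrow> indicator {0<..<T} t * E (x, t)) = 0" if "z \<notin> cball 0 R \<times> {0..T}"
      using that E_off by (cases z) (auto simp: indicator_def simp del: mem_cball_0)
  qed
  have E'_int: "integrable (lborel \<Otimes>\<^sub>M lborel) (\<lambda>(x, t). indicator {0<..<T} t * E' (x, t))"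
    unfolding lborel_prod
  proof (rule integrable_bounded_support[OF F_meas[OF E_meas(2)]])
    show "bounded (S \<times> {0..T})" "S \<times> {0..T} \<in> sets borel"
      by (auto intro!: bounded_Times borel_closed closed_Times simp: S_def)
    fix z
    show "\<bar>case z of (x, t) \<Rightarrow> indicator {0<..<T} t * E' (x, t)\<bar> \<le> M * (Ct + 2 * Cf * CK) + \<bar>\<mu>\<bar> * M powr p * Cf"
      if "z \<in> S \<times> {0..T}"
    proof -
      have "\<bar>case z of (x, t) \<Rightarrow> indicator {0<..<T} t * E' (x, t)\<bar> \<le> \<bar>E' z\<bar>"
        by (cases z) (auto simp: indicator_def)
      then show ?thesis using that E'_bd[of "snd z" "fst z"] by (cases z) auto
    qed
    show "(case z of (x, t) \<Rightarrow> indicator {0<..<T} t * E' (x, t)) = 0" if "z \<notin> S \<times> {0..T}"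
      using that E'_off by (cases z) (auto simp: indicator_def simp del: mem_cball_0)
  qed
  \<comment> \<open>The equation holds for t > 0 only; continuity up to t = 0 lets the fundamental
    theorem of calculus reach the initial value.\<close>
  have ftc: "AE x in lborel. w (x, T) * f (x, T) - w (x, 0) * f (x, 0) = (LINT t|lborel. indicator {0<..<T} t * E (x, t))"
    using w_ode
  proof eventually_elim
    case (elim x)
    have "((\<lambda>t. w (x, t) * f (x, t)) has_vector_derivative E (x, t)) (at t)" if "t \<in> {0<..<T}" for t
      unfolding has_real_derivative_iff_has_vector_derivative[symmetric] E_def
      using elim that smooth_time_derivative[OF f(1), of x t]
      by (auto intro!: derivative_eq_intros)
    moreover have "continuous_on {0..T} (\<lambda>t. w (x, t) * f (x, t))"
      by (intro continuous_intros continuous_on_subset[OF w_cont] continuous_on_compose2[OF f_cont]) auto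
    ultimately have "((\<lambda>t. E (x, t)) has_integral (w (x, T) * f (x, T) - w (x, 0) * f (x, 0))) {0<..<T}"
      unfolding has_integral_Icc_iff_Ioo[symmetric]
      by (intro fundamental_theorem_of_calculus_interior T) auto
    moreover have "set_integrable lborel {0<..<T} (\<lambda>t. E (x, t))"
      by (rule set_integrable_bounded[where C = "Cf * (2 * M * CK + \<bar>\<mu>\<bar> * M powr p) + M * Ct"])
         (use E_bd in auto)
    ultimately show ?case
      using set_borel_integral_eq_integral(2)[of "{0<..<T}" "\<lambda>t. E (x, t)"]
      by (simp add: set_lebesgue_integral_def integral_unique)
  qed
  have wf_int: "integrable lborel (\<lambda>x. w (x, t) * f (x, t))" if "t \<in> {0..T}" for t
    by (rule integrable_bounded_support[where A = "cball 0 R" and C = "M * Cf"])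
       (use f(2) that wM Cf M0 in \<open>auto simp: vanishes_off_def abs_mult not_le intro!: mult_mono\<close>)
  have "(LINT x|lborel. w (x, T) * f (x, T)) - (LINT x|lborel. w (x, 0) * f (x, 0)) =
      (LINT x|lborel. w (x, T) * f (x, T) - w (x, 0) * f (x, 0))"
    using wf_int T by simp
  also have "\<dots> = (LINT x|lborel. LINT t|lborel. indicator {0<..<T} t * E (x, t))"
    by (rule integral_cong_AE) (use ftc in measurable)
  also have "\<dots> = (LINT t|lborel. LINT x|lborel. indicator {0<..<T} t * E (x, t))"
    by (rule lborel_pair.Fubini_integral[OF E_int, symmetric])
  also have "\<dots> = (LINT t|lborel. LINT x|lborel. indicator {0<..<T} t * E' (x, t))"
  proof (rule Bochner_Integration.integral_cong[OF refl])
    fix t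
    show "(LINT x|lborel. indicator {0<..<T} t * E (x, t)) = (LINT x|lborel. indicator {0<..<T} t * E' (x, t))"
    proof (cases "t \<in> {0..T}")
      case t: True
      \<comment> \<open>The terms common to \<open>E\<close> and \<open>E'\<close>, split off so
        that only the operator terms have to be exchanged.\<close>
      define D where "D x = w (x, t) * time_deriv f (x, t) - \<mu> * w (x, t) powr p * f (x, t)" for x
      have D_int: "integrable lborel D"
        unfolding D_def[abs_def]
      proof (rule integrable_bounded_support[where A = "cball 0 R" and C = "M * Ct + \<bar>\<mu>\<bar> * M powr p * Cf"])
        fix x
        have "\<bar>w (x, t) * time_deriv f (x, t)\<bar> \<le> M * Ct"
          unfolding abs_mult using Ct t wM M0 by (intro mult_mono) auto
        moreover have "\<bar>\<mu> * w (x, t) powr p * f (x, t)\<bar> \<le> \<bar>\<mu>\<bar> * M powr p * Cf"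
          unfolding abs_mult using wp t Cf M0 by (intro mult_mono) auto
        ultimately show "\<bar>w (x, t) * time_deriv f (x, t) - \<mu> * w (x, t) powr p * f (x, t)\<bar>
            \<le> M * Ct + \<bar>\<mu>\<bar> * M powr p * Cf" by linarith
      qed (use f(2) ft_off in \<open>auto simp: vanishes_off_def not_le\<close>)
      have op_meas: "(\<lambda>x. nonlocal_op K g x t) \<in> borel_measurable borel"
        if [measurable]: "g \<in> borel_measurable borel" for g
        using measurable_compose[OF _ nonlocal_op_measurable[OF that], of "\<lambda>x. (x, t)" borel] by simp
      have 1: "integrable lborel (\<lambda>x. f (x, t) * nonlocal_op K w x t)"
      proof (rule integrable_bounded_support[where A = "cball 0 R" and C = "Cf * (2 * M * CK)"])
        fix x
        have "\<bar>nonlocal_op K w x t\<bar> \<le> 2 * M * CK"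
          unfolding CK_def using t wM by (intro abs_nonlocal_op_le w_meas) auto
        then show "\<bar>f (x, t) * nonlocal_op K w x t\<bar> \<le> Cf * (2 * M * CK)"
          unfolding abs_mult using Cf t by (intro mult_mono) auto
      qed (use f(2) op_meas[of w] in \<open>auto simp: vanishes_off_def not_le\<close>)
      have 2: "integrable lborel (\<lambda>x. w (x, t) * nonlocal_op K f x t)"
      proof (rule integrable_bounded_support[where A = S and C = "M * (2 * Cf * CK)"])
        fix x
        have "\<bar>nonlocal_op K f x t\<bar> \<le> 2 * Cf * CK"
          unfolding CK_def using t Cf by (intro abs_nonlocal_op_le) auto
        then show "\<bar>w (x, t) * nonlocal_op K f x t\<bar> \<le> M * (2 * Cf * CK)"
          unfolding abs_mult using wM t M0 by (intro mult_mono) auto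
      next
        fix x assume "x \<notin> S"
        then show "w (x, t) * nonlocal_op K f x t = 0"
          using nonlocal_op_support[OF f(2)] by (simp add: S_def not_le)
      qed (use op_meas[of f] in \<open>auto simp: S_def\<close>)
      have "(LINT x|lborel. E (x, t)) = (LINT x|lborel. f (x, t) * nonlocal_op K w x t + D x)"
        by (simp add: E_def D_def algebra_simps)
      also have "\<dots> = (LINT x|lborel. f (x, t) * nonlocal_op K w x t) + (LINT x|lborel. D x)"
        using 1 D_int by simp
      also have "(LINT x|lborel. f (x, t) * nonlocal_op K w x t) = (LINT x|lborel. w (x, t) * nonlocal_op K f x t)"
        by (rule nonlocal_op_symmetric[OF w_meas wM f_cont f(2)]) (use t in auto)
      also have "\<dots> + (LINT x|lborel. D x) = (LINT x|lborel. w (x, t) * nonlocal_op K f x t + D x)"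
        using 2 D_int by simp
      also have "\<dots> = (LINT x|lborel. E' (x, t))"
        by (simp add: E'_def D_def algebra_simps)
      finally show ?thesis by simp
    qed (auto simp: indicator_def)
  qed
  also have "\<dots> = (LINT z|(lborel \<Otimes>\<^sub>M lborel). (case z of (x, t) \<Rightarrow> indicator {0<..<T} t * E' (x, t)))"
    by (rule lborel_pair.integral_snd[OF E'_int])
  also have "\<dots> = (LINT z:S \<times> {0<..<T}|lborel. E' z)"
    unfolding lborel_prod set_lebesgue_integral_def
  proof (rule Bochner_Integration.integral_cong[OF refl])
    fix z
    show "(case z of (x, t) \<Rightarrow> indicator {0<..<T} t * E' (x, t)) = indicator (S \<times> {0<..<T}) z *\<^sub>R E' z"
      by (cases z; cases "fst z \<in> S") (auto simp: indicator_def E'_off)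
  qed
  finally show ?thesis by (simp add: E'_def)
qed

end

subsection \<open>Rescaling\<close>

lemma AE_lborel_scaleR:
  fixes P :: "'a::euclidean_space \<Rightarrow> bool"
  assumes "AE x in lborel. P x" and "c \<noteq> 0"
  shows "AE x in lborel. P (c *\<^sub>R x)"
proof -
  let ?D = "distr lborel borel (\<lambda>x :: 'a. 0 + c *\<^sub>R x)"
  obtain N where N: "{x. \<not> P x} \<subseteq> N" "emeasure lborel N = 0" "N \<in> sets lborel"
    using AE_E[OF assms(1)] by auto
  then have "N \<in> null_sets lborel" by auto
  also have "(lborel :: 'a measure) = density ?D (\<lambda>_. ennreal (\<bar>c\<bar> ^ DIM('a)))"
    using lborel_affine[OF \<open>c \<noteq> 0\<close>, of 0] by (simp add: ennreal_power)
  finally have "AE x in ?D. x \<notin> N"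
    using \<open>c \<noteq> 0\<close> by (subst (asm) null_sets_density_iff) auto
  then have "AE x in lborel. 0 + c *\<^sub>R x \<notin> N"
    using N(3) by (subst (asm) AE_distr_iff) auto
  then show ?thesis by eventually_elim (use N(1) in auto)
qed

lemma bounded_kernel_scaled:
  assumes "bounded_kernel J \<rho>" "0 < r"
  shows "bounded_kernel (scaled_kernel J r) (\<rho> / r)"
proof -
  interpret bounded_kernel J \<rho> by fact
  show ?thesis
  proof
    show "continuous_on UNIV (scaled_kernel J r)"
      unfolding scaled_kernel_def by (intro continuous_intros continuous_on_compose2[OF K_cont]) auto
    show "scaled_kernel J r (- z) = scaled_kernel J r z" for z
      by (simp add: scaled_kernel_def K_even)
    show "scaled_kernel J r z = 0" if "\<rho> / r < norm z" for z
    proof -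
      have "\<rho> < norm (r *\<^sub>R z)" using that \<open>0 < r\<close> by (simp add: pos_divide_less_eq mult.commute)
      then show ?thesis by (simp add: scaled_kernel_def K_supp)
    qed
    show "0 \<le> \<rho> / r" using \<rho> \<open>0 < r\<close> by simp
  qed
qed

section \<open>Regular representatives of solutions and their scaling\<close>

text \<open>Measurability is given on nonnegative times only. Freezing \<open>u\<close> at its
  initial value for negative times amounts to composing with a continuous retraction of space-time
  onto that half-space.\<close>

lemma nonlocal_solution_measurable:
  assumes "nonlocal_solution J p u0 u"
  shows "(\<lambda>z. u (fst z) (max 0 (snd z))) \<in> borel_measurable borel"
proof -
  have 1: "(\<lambda>z. case z of (x, t) \<Rightarrow> u x t) \<in> borel_measurable (restrict_space borel (UNIV \<times> {0..}))"
    using assms by (simp add: nonlocal_solution_def)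
  have 2: "(\<lambda>z :: 'a \<times> real. (fst z, max 0 (snd z))) \<in> borel \<rightarrow>\<^sub>M restrict_space borel (UNIV \<times> {0..})"
  proof (rule measurable_restrict_space2)
    show "(\<lambda>z :: 'a \<times> real. (fst z, max 0 (snd z))) \<in> borel \<rightarrow>\<^sub>M borel"
      by (intro borel_measurable_continuous_onI continuous_intros)
  qed auto
  from measurable_compose[OF 2 1] show ?thesis by (simp only: split)
qed

text \<open>All exceptional points are collected in one null set, over which the solution is set to
  0. The equation survives at the remaining points because the altered values enter it only through
  an integral over \<open>y\<close>.\<close>

lemma nonlocal_solution_imp_regular:
  fixes J :: "'a::euclidean_space \<Rightarrow> real"
  assumes J [measurable]: "J \<in> borel_measurable borel" and u: "nonlocal_solution J p u0 u"
  obtains w where "regular_solution J 1 p w" "AE x in lborel. \<forall>t\<ge>0. w (x, t) = u x t"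
    "AE x in lborel. w (x, 0) = u0 x"
proof -
  \<comment> \<open>The exceptional set of the bound depends on the time horizon. The horizons
    \<open>real n + 1\<close> are positive, countable in number and exhaust all times, so a single
    null set serves them all.\<close>
  have "\<exists>M. AE x in lborel. \<forall>t\<in>{0..real n + 1}. u x t \<le> M" for n
  proof -
    have "\<forall>T>0. \<exists>M. AE x in lborel. \<forall>t\<in>{0..T}. u x t \<le> M"
      using u unfolding nonlocal_solution_def by (elim conjE)
    then have "0 < real n + 1 \<longrightarrow> (\<exists>M. AE x in lborel. \<forall>t\<in>{0..real n + 1}. u x t \<le> M)" by (rule spec)
    then show ?thesis by (rule mp) linarith
  qed
  then have "\<exists>M. \<forall>n. AE x in lborel. \<forall>t\<in>{0..real n + 1}. u x t \<le> M n"
    by (intro choice allI)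
  then obtain M where M: "\<forall>n. AE x in lborel. \<forall>t\<in>{0..real n + 1}. u x t \<le> M n" ..
  define good where "good x \<longleftrightarrow> u x 0 = u0 x \<and> (\<forall>t\<ge>0. 0 \<le> u x t) \<and> continuous_on {0..} (u x) \<and>
        (\<forall>t>0. (u x has_real_derivative
           (LINT y|lborel. J (x - y) * (u y t - u x t)) - u x t powr p) (at t)) \<and>
        (\<forall>n. \<forall>t\<in>{0..real n + 1}. u x t \<le> M n)" for x
  have "AE x in lborel. \<forall>n. \<forall>t\<in>{0..real n + 1}. u x t \<le> M n"
    using M unfolding AE_all_countable .
  moreover have "AE x in lborel. u x 0 = u0 x \<and> (\<forall>t\<ge>0. 0 \<le> u x t) \<and> continuous_on {0..} (u x) \<and>
        (\<forall>t>0. (u x has_real_derivative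
           (LINT y|lborel. J (x - y) * (u y t - u x t)) - u x t powr p) (at t))"
    using u unfolding nonlocal_solution_def by (elim conjE)
  ultimately have "AE x in lborel. good x"
    unfolding good_def by eventually_elim (intro conjI; elim conjE; assumption)
  \<comment> \<open>The set of bad points need not be Borel; a Borel null set containing it keeps
    \<open>w\<close> measurable.\<close>
  then obtain N where "{x \<in> space lborel. \<not> good x} \<subseteq> N" and N: "emeasure lborel N = 0" "N \<in> sets lborel"
    by (rule AE_E)
  then have bad: "{x. \<not> good x} \<subseteq> N" by simp
  have [measurable]: "N \<in> sets borel" using N(2) by simp
  have good: "good x" if "x \<notin> N" for x using bad that by auto
  have AE_N: "AE x in lborel. x \<notin> N" using N by (intro AE_not_in) auto
  define w where "w z = (if fst z \<in> N then 0 else u (fst z) (max 0 (snd z)))" for z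
  have w_meas: "w \<in> borel_measurable borel"
  proof -
    have [measurable]: "(\<lambda>z. u (fst z) (max 0 (snd z))) \<in> borel_measurable (borel \<Otimes>\<^sub>M borel)"
      using nonlocal_solution_measurable[OF u] by (simp add: borel_prod)
    have "w \<in> borel_measurable (borel \<Otimes>\<^sub>M borel)"
      unfolding w_def[abs_def] by measurable
    then show ?thesis by (simp add: borel_prod)
  qed
  have w_u: "w (x, t) = u x t" if "x \<notin> N" "0 \<le> t" for x t
    using that by (simp add: w_def max_def)
  have "regular_solution J 1 p w"
    unfolding regular_solution_def
  proof (intro conjI allI w_meas)
    show "0 \<le> w z" for z
      using good[of "fst z"] by (auto simp: w_def good_def)
    show "\<exists>M. \<forall>x. \<forall>t\<le>T. w (x, t) \<le> M" for T
    proof -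
      obtain n where n: "T \<le> real n" using real_arch_simple by blast
      have "w (x, t) \<le> max 0 (M n)" if "t \<le> T" for x t
      proof (cases "x \<in> N")
        case False
        have "max 0 t \<in> {0..real n + 1}" using that n by auto
        then have "u x (max 0 t) \<le> M n" using good[OF False] unfolding good_def by blast
        then show ?thesis using False by (simp add: w_def)
      qed (simp add: w_def)
      then show ?thesis by blast
    qed
    show "continuous_on {0..} (\<lambda>t. w (x, t))" for x
    proof (cases "x \<in> N")
      case False
      then have "continuous_on {0..} (u x)" using good by (simp add: good_def)
      then show ?thesis by (rule continuous_on_eq) (use False in \<open>simp add: w_u\<close>)
    qed (simp add: w_def)
    show "AE x in lborel. \<forall>t>0. ((\<lambda>t. w (x, t)) has_real_derivative
        nonlocal_op J w x t - 1 * w (x, t) powr p) (at t)"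
      using AE_N
    proof (eventually_elim, intro allI impI)
      fix x :: 'a and t :: real assume x: "x \<notin> N" and t: "0 < t"
      have "nonlocal_op J w x t = (LINT y|lborel. J (x - y) * (u y t - u x t))"
        unfolding nonlocal_op_def
      proof (rule integral_cong_AE)
        have u_slice [measurable]: "(\<lambda>y. u y t) \<in> borel_measurable borel"
          using measurable_compose[OF _ nonlocal_solution_measurable[OF u], of "\<lambda>y. (y, t)" borel] t
          by (simp add: max_def)
        have w_slice [measurable]: "(\<lambda>y. w (y, t)) \<in> borel_measurable borel"
          using measurable_compose[OF _ w_meas, of "\<lambda>y. (y, t)" borel] by simp
        show "(\<lambda>y. J (x - y) * (u y t - u x t)) \<in> borel_measurable lborel"
          "(\<lambda>y. J (x - y) * (w (y, t) - w (x, t))) \<in> borel_measurable lborel" by measurable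
        show "AE y in lborel. J (x - y) * (w (y, t) - w (x, t)) = J (x - y) * (u y t - u x t)"
          using AE_N by eventually_elim (use x t in \<open>simp add: w_u\<close>)
      qed
      moreover have "(u x has_real_derivative
           (LINT y|lborel. J (x - y) * (u y t - u x t)) - u x t powr p) (at t)"
        using good[OF x] t by (simp add: good_def)
      ultimately have "(u x has_real_derivative nonlocal_op J w x t - 1 * w (x, t) powr p) (at t)"
        using x t by (simp add: w_u)
      then show "((\<lambda>t. w (x, t)) has_real_derivative nonlocal_op J w x t - 1 * w (x, t) powr p) (at t)"
        by (rule has_field_derivative_transform_within_open[of _ _ _ "{0<..}"])
           (use t x in \<open>auto simp: w_u\<close>)
    qed
  qed
  moreover have "AE x in lborel. \<forall>t\<ge>0. w (x, t) = u x t"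
    using AE_N by eventually_elim (simp add: w_u)
  moreover have "AE x in lborel. w (x, 0) = u0 x"
    using AE_N by eventually_elim (use good in \<open>simp add: w_u good_def\<close>)
  ultimately show ?thesis by (rule that)
qed

text \<open>The time derivative gains the factor \<open>s * r\<^sup>2\<close>, and a dilation of the
  integration variable gives the operator the same factor. In the absorption,
  \<open>s * r\<^sup>2\<close> times the power of \<open>w\<close> is
  \<open>s powr (1 - p) * r\<^sup>2\<close> times the power of \<open>s * w\<close>: for
  \<open>s = scale_f u0 r\<close> this is the origin of \<open>scale_F\<close>.\<close>

lemma regular_solution_rescale:
  fixes J :: "'a::euclidean_space \<Rightarrow> real"
  assumes J [measurable]: "J \<in> borel_measurable borel" and w: "regular_solution J 1 p w" and r: "0 < r" and s: "0 < s"
  shows "regular_solution (scaled_kernel J r) (s powr (1 - p) * r\<^sup>2) p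
    (\<lambda>z. s * w (r *\<^sub>R fst z, r\<^sup>2 * snd z))" (is "regular_solution _ _ _ ?v")
proof -
  have w_meas: "w \<in> borel_measurable borel" and w0: "\<And>z. 0 \<le> w z"
    and w_bd: "\<And>T. \<exists>M. \<forall>x. \<forall>t\<le>T. w (x, t) \<le> M"
    and w_cont: "\<And>x. continuous_on {0..} (\<lambda>t. w (x, t))"
    and w_ode: "AE x in lborel. \<forall>t>0. ((\<lambda>t. w (x, t)) has_real_derivative
        nonlocal_op J w x t - w (x, t) powr p) (at t)"
    using w unfolding regular_solution_def by auto
  have slice: "(\<lambda>y. w (y, t)) \<in> borel_measurable borel" for t
    using measurable_compose[OF _ w_meas, of "\<lambda>y. (y, t)" borel] by simp
  have op: "nonlocal_op (scaled_kernel J r) ?v x t = s * r\<^sup>2 * nonlocal_op J w (r *\<^sub>R x) (r\<^sup>2 * t)" for x t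
  proof -
    note [measurable] = slice[of "r\<^sup>2 * t"]
    have "nonlocal_op J w (r *\<^sub>R x) (r\<^sup>2 * t) = \<bar>r\<bar> ^ DIM('a) *
        (LINT y|lborel. J (r *\<^sub>R x - (0 + r *\<^sub>R y)) * (w (0 + r *\<^sub>R y, r\<^sup>2 * t) - w (r *\<^sub>R x, r\<^sup>2 * t)))"
      unfolding nonlocal_op_def using r by (intro integral_lborel_affine) auto
    then have "s * r\<^sup>2 * nonlocal_op J w (r *\<^sub>R x) (r\<^sup>2 * t) =
        (LINT y|lborel. s * r\<^sup>2 * r ^ DIM('a) *
          (J (r *\<^sub>R x - r *\<^sub>R y) * (w (r *\<^sub>R y, r\<^sup>2 * t) - w (r *\<^sub>R x, r\<^sup>2 * t))))"
      using r by simp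
    also have "\<dots> = nonlocal_op (scaled_kernel J r) ?v x t"
      unfolding nonlocal_op_def scaled_kernel_def
      by (intro Bochner_Integration.integral_cong) (simp_all add: algebra_simps)
    finally show ?thesis by simp
  qed
  show ?thesis
    unfolding regular_solution_def
  proof (intro conjI allI)
    have "(\<lambda>z. (r *\<^sub>R fst z, r\<^sup>2 * snd z)) \<in> (borel :: ('a \<times> real) measure) \<rightarrow>\<^sub>M borel"
      by (intro borel_measurable_continuous_onI continuous_intros)
    from measurable_compose[OF this w_meas] show "?v \<in> borel_measurable borel" by simp
    show "0 \<le> ?v z" for z using w0 s by simp
    show "\<exists>M. \<forall>x. \<forall>t\<le>T. ?v (x, t) \<le> M" for T
    proof -
      obtain M where M: "\<And>x t. t \<le> r\<^sup>2 * T \<Longrightarrow> w (x, t) \<le> M" using w_bd by metis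
      have "?v (x, t) \<le> s * M" if "t \<le> T" for x t
        using M[of "r\<^sup>2 * t" "r *\<^sub>R x"] that s r by simp
      then show ?thesis by blast
    qed
    show "continuous_on {0..} (\<lambda>t. ?v (x, t))" for x
      unfolding fst_conv snd_conv
      by (intro continuous_intros continuous_on_compose2[OF w_cont]) auto
    show "AE x in lborel. \<forall>t>0. ((\<lambda>t. ?v (x, t)) has_real_derivative
        nonlocal_op (scaled_kernel J r) ?v x t - s powr (1 - p) * r\<^sup>2 * ?v (x, t) powr p) (at t)"
      using AE_lborel_scaleR[OF w_ode less_imp_neq[OF r, symmetric]]
    proof eventually_elim
      case (elim x)
      show ?case
      proof (intro allI impI)
        fix t :: real assume t: "0 < t"
        let ?w = "w (r *\<^sub>R x, r\<^sup>2 * t)"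
        have "((\<lambda>t. w (r *\<^sub>R x, t)) has_real_derivative
            nonlocal_op J w (r *\<^sub>R x) (r\<^sup>2 * t) - ?w powr p) (at (r\<^sup>2 * t))"
          using elim t r by simp
        moreover have "((\<lambda>t. r\<^sup>2 * t) has_real_derivative r\<^sup>2) (at t)"
          by (auto intro!: derivative_eq_intros)
        ultimately have "((\<lambda>t. w (r *\<^sub>R x, r\<^sup>2 * t)) has_real_derivative
            (nonlocal_op J w (r *\<^sub>R x) (r\<^sup>2 * t) - ?w powr p) * r\<^sup>2) (at t)"
          by (rule DERIV_chain2)
        from DERIV_cmult[OF this, of s]
        have "((\<lambda>t. s * w (r *\<^sub>R x, r\<^sup>2 * t)) has_real_derivative
            s * ((nonlocal_op J w (r *\<^sub>R x) (r\<^sup>2 * t) - ?w powr p) * r\<^sup>2)) (at t)" .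
        moreover have eq: "s powr (1 - p) * r\<^sup>2 * (s * ?w) powr p = s * r\<^sup>2 * ?w powr p"
        proof -
          have "s powr (1 - p) * s powr p = s" using s by (simp add: powr_add[symmetric])
          then show ?thesis using s w0 by (simp add: powr_mult algebra_simps)
        qed
        ultimately show "((\<lambda>t. ?v (x, t)) has_real_derivative
            nonlocal_op (scaled_kernel J r) ?v x t - s powr (1 - p) * r\<^sup>2 * ?v (x, t) powr p) (at t)"
          unfolding op fst_conv snd_conv eq by (simp only: algebra_simps)
      qed
    qed
  qed
qed

lemma rescale_sol_regular:
  fixes J :: "'a::euclidean_space \<Rightarrow> real"
  assumes J [measurable]: "J \<in> borel_measurable borel" and u: "nonlocal_solution J p u0 u"
    and r: "0 < r" and s: "0 < scale_f u0 r"
  obtains v where "regular_solution (scaled_kernel J r) (scale_F p u0 r) p v"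
    "AE x in lborel. \<forall>t\<ge>0. v (x, t) = rescale_sol u0 u r x t"
    "AE x in lborel. v (x, 0) = rescale_data u0 r x"
proof -
  obtain w where w: "regular_solution J 1 p w" "AE x in lborel. \<forall>t\<ge>0. w (x, t) = u x t"
    "AE x in lborel. w (x, 0) = u0 x"
    using J u by (rule nonlocal_solution_imp_regular)
  show ?thesis
  proof (rule that)
    show "regular_solution (scaled_kernel J r) (scale_F p u0 r) p
        (\<lambda>z. scale_f u0 r * w (r *\<^sub>R fst z, r\<^sup>2 * snd z))"
      unfolding scale_F_def using J w(1) r s by (rule regular_solution_rescale)
    show "AE x in lborel. \<forall>t\<ge>0. scale_f u0 r * w (r *\<^sub>R fst (x, t), r\<^sup>2 * snd (x, t)) = rescale_sol u0 u r x t"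
      using AE_lborel_scaleR[OF w(2) less_imp_neq[OF r, symmetric]] by eventually_elim (simp add: rescale_sol_def)
    show "AE x in lborel. scale_f u0 r * w (r *\<^sub>R fst (x, 0::real), r\<^sup>2 * snd (x, 0::real)) = rescale_data u0 r x"
      using AE_lborel_scaleR[OF w(3) less_imp_neq[OF r, symmetric]] by eventually_elim (simp add: rescale_data_def)
  qed
qed

lemma rescale_sol_measurable:
  assumes u: "nonlocal_solution J p u0 u"
  shows "(\<lambda>z. rescale_sol u0 u r (fst z) (max 0 (snd z))) \<in> borel_measurable borel"
proof -
  have "(\<lambda>z. (r *\<^sub>R fst z, r\<^sup>2 * snd z)) \<in> (borel :: ('a \<times> real) measure) \<rightarrow>\<^sub>M borel"
    by (intro borel_measurable_continuous_onI continuous_intros)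
  from measurable_compose[OF this nonlocal_solution_measurable[OF u]]
  have "(\<lambda>z. u (r *\<^sub>R fst z) (max 0 (r\<^sup>2 * snd z))) \<in> borel_measurable borel" by simp
  moreover have "max 0 (r\<^sup>2 * t) = r\<^sup>2 * max 0 t" for t :: real
    by (auto simp: max_def zero_le_mult_iff)
  ultimately show ?thesis unfolding rescale_sol_def by simp
qed

subsection \<open>Passage to the limit\<close>

lemma AE_lborel_fst:
  fixes P :: "'a::euclidean_space \<Rightarrow> bool"
  assumes "AE x in lborel. P x"
  shows "AE z in (lborel :: ('a \<times> 'b::euclidean_space) measure). P (fst z)"
proof -
  obtain N where N: "{x \<in> space lborel. \<not> P x} \<subseteq> N" "emeasure lborel N = 0" "N \<in> sets lborel"
    using assms by (rule AE_E)
  have "emeasure (lborel \<Otimes>\<^sub>M lborel) (N \<times> (UNIV :: 'b set)) = emeasure lborel N * emeasure lborel (UNIV :: 'b set)"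
    using N(3) by (intro lborel.emeasure_pair_measure_Times) auto
  \<comment> \<open>The second factor has infinite measure; the product is 0 because
    \<open>0 * \<infinity> = 0\<close> in \<open>ennreal\<close>.\<close>
  then have 0: "emeasure lborel (N \<times> (UNIV :: 'b set)) = 0"
    using N(2) by (simp add: lborel_prod)
  have "N \<times> (UNIV :: 'b set) \<in> sets borel"
    using N(3) unfolding borel_prod[symmetric] by (intro pair_measureI) auto
  then have "N \<times> (UNIV :: 'b set) \<in> null_sets lborel"
    using 0 by (simp add: null_sets_def)
  then show ?thesis by (rule AE_I') (use N(1) in auto)
qed

text \<open>Connects the iterated integrals in the assumed bounds with the space-time integrals on
  which the convergence theorems operate.\<close>

lemma set_lborel_integral_Times:
  fixes g :: "'a::euclidean_space \<times> real \<Rightarrow> real"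
  assumes "g \<in> borel_measurable borel" "A \<in> sets borel" "B \<in> sets borel" "bounded A" "bounded B"
    and "\<And>x t. t \<in> B \<Longrightarrow> \<bar>g (x, t)\<bar> \<le> M"
  shows "(LINT t:B|lborel. (LINT x:A|lborel. g (x, t))) = (LINT z:A \<times> B|lborel. g z)"
proof -
  have AB: "A \<times> B \<in> sets borel"
    unfolding borel_prod[symmetric] using assms by (intro pair_measureI)
  have "set_integrable lborel (A \<times> B) g"
    by (rule set_integrable_bounded[OF assms(1) AB bounded_Times[OF assms(4,5)], of M]) (use assms(6) in auto)
  then have int: "integrable (lborel \<Otimes>\<^sub>M lborel) (\<lambda>(x, t). indicator B t * (indicator A x * g (x, t)))"
    unfolding set_integrable_def lborel_prod
    by (rule Bochner_Integration.integrable_cong[THEN iffD1, rotated -1]) (auto simp: indicator_def)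
  have "(LINT t:B|lborel. (LINT x:A|lborel. g (x, t))) =
      (LINT t|lborel. LINT x|lborel. indicator B t * (indicator A x * g (x, t)))"
    unfolding set_lebesgue_integral_def by simp
  also have "\<dots> = (LINT z|(lborel \<Otimes>\<^sub>M lborel). (case z of (x, t) \<Rightarrow> indicator B t * (indicator A x * g (x, t))))"
    by (rule lborel_pair.integral_snd[OF int])
  also have "\<dots> = (LINT z:A \<times> B|lborel. g z)"
    unfolding lborel_prod set_lebesgue_integral_def
    by (intro Bochner_Integration.integral_cong) (auto simp: indicator_def)
  finally show ?thesis .
qed

text \<open>Serves on cylinders that reach t = 0, where no dominating function is at hand and only
  the integrals are bounded; hence only integrability of the limit is claimed, not convergence of
  the integrals.\<close>

lemma set_integrable_fatou:
  fixes g :: "nat \<Rightarrow> 'b::euclidean_space \<Rightarrow> real"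
  assumes g: "\<And>n. set_integrable lborel A (g n)" and g0: "\<And>n z. z \<in> A \<Longrightarrow> 0 \<le> g n z"
    and bound: "\<forall>\<^sub>F n in sequentially. (LINT z:A|lborel. g n z) \<le> C"
    and h: "set_borel_measurable lborel A h"
    and lim: "AE z in lborel. z \<in> A \<longrightarrow> (\<lambda>n. g n z) \<longlonglongrightarrow> h z"
  shows "set_integrable lborel A h"
proof -
  define G where "G n z = indicator A z *\<^sub>R g n z" for n z
  have G_int: "integrable lborel (G n)" for n using g unfolding G_def[abs_def] set_integrable_def .
  then have [measurable]: "G n \<in> borel_measurable lborel" for n by auto
  have G0: "0 \<le> G n z" for n z using g0 by (auto simp: G_def indicator_def)
  have "(\<integral>\<^sup>+z. ennreal (norm (indicator A z *\<^sub>R h z)) \<partial>lborel) \<le> (\<integral>\<^sup>+z. liminf (\<lambda>n. ennreal (G n z)) \<partial>lborel)"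
  proof (rule nn_integral_mono_AE, use lim in eventually_elim)
    case (elim z)
    have "(\<lambda>n. G n z) \<longlonglongrightarrow> indicator A z *\<^sub>R h z"
      using elim by (cases "z \<in> A") (auto simp: G_def)
    moreover from this have "0 \<le> indicator A z *\<^sub>R h z"
      by (rule LIMSEQ_le_const) (use G0 in auto)
    ultimately have "(\<lambda>n. ennreal (G n z)) \<longlonglongrightarrow> ennreal (norm (indicator A z *\<^sub>R h z))" by simp
    then show ?case by (simp add: lim_imp_Liminf)
  qed
  also have "\<dots> \<le> liminf (\<lambda>n. \<integral>\<^sup>+z. ennreal (G n z) \<partial>lborel)"
    by (rule nn_integral_liminf) simp
  also have "\<dots> \<le> liminf (\<lambda>n. ennreal C)"
  proof (rule Liminf_mono, use bound in eventually_elim)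
    case (elim n)
    have "(\<integral>\<^sup>+z. ennreal (G n z) \<partial>lborel) = ennreal (LINT z|lborel. G n z)"
      by (rule nn_integral_eq_integral[OF G_int]) (use G0 in auto)
    then show ?case using elim unfolding set_lebesgue_integral_def G_def by (simp add: ennreal_leI)
  qed
  also have "\<dots> < \<infinity>" by (simp add: Liminf_const)
  finally show ?thesis
    using h unfolding set_integrable_def set_borel_measurable_def integrable_iff_bounded by simp
qed

lemma set_bounded_convergence:
  fixes g :: "nat \<Rightarrow> 'b::euclidean_space \<Rightarrow> real"
  assumes A: "A \<in> sets borel" "bounded A" and g: "\<And>n. g n \<in> borel_measurable borel"
    and bound: "\<forall>\<^sub>F n in sequentially. AE z in lborel. z \<in> A \<longrightarrow> \<bar>g n z\<bar> \<le> C"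
    and h: "set_borel_measurable lborel A h"
    and lim: "AE z in lborel. z \<in> A \<longrightarrow> (\<lambda>n. g n z) \<longlonglongrightarrow> h z"
  shows "set_integrable lborel A h" "(\<lambda>n. LINT z:A|lborel. g n z) \<longlonglongrightarrow> (LINT z:A|lborel. h z)"
proof -
  \<comment> \<open>The constant bound holds for late indices only, so the first \<open>m\<close>
    terms are dropped before dominated convergence and restored by an index shift at the
    end.\<close>
  obtain m where m: "\<And>n. AE z in lborel. z \<in> A \<longrightarrow> \<bar>g (n + m) z\<bar> \<le> C"
    using bound unfolding eventually_sequentially by (metis le_add2)
  define G where "G n z = indicator A z *\<^sub>R g (n + m) z" for n z
  have [measurable]: "A \<in> sets borel" "g n \<in> borel_measurable borel" for n using A g by auto
  have dom: "integrable lborel (\<lambda>z. indicator A z *\<^sub>R C)"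
    using set_integrable_bounded[of "\<lambda>_. C" A "\<bar>C\<bar>"] A by (simp add: set_integrable_def)
  have meas: "(\<lambda>z. indicator A z *\<^sub>R h z) \<in> borel_measurable lborel"
    using h by (simp add: set_borel_measurable_def)
  have G_meas: "G n \<in> borel_measurable lborel" for n unfolding G_def[abs_def] by measurable
  have G_lim: "AE z in lborel. (\<lambda>n. G n z) \<longlonglongrightarrow> indicator A z *\<^sub>R h z"
    using lim
  proof eventually_elim
    case (elim z)
    then show ?case
      by (cases "z \<in> A") (auto simp: G_def intro: LIMSEQ_ignore_initial_segment)
  qed
  have G_bound: "AE z in lborel. norm (G n z) \<le> indicator A z *\<^sub>R C" for n
    using m[of n] by eventually_elim (auto simp: G_def indicator_def)
  show "set_integrable lborel A h"
    unfolding set_integrable_def by (rule integrable_dominated_convergence[OF meas G_meas dom G_lim G_bound])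
  have "(\<lambda>n. LINT z|lborel. G n z) \<longlonglongrightarrow> (LINT z|lborel. indicator A z *\<^sub>R h z)"
    by (rule integral_dominated_convergence[OF meas G_meas dom G_lim G_bound])
  then show "(\<lambda>n. LINT z:A|lborel. g n z) \<longlonglongrightarrow> (LINT z:A|lborel. h z)"
    unfolding set_lebesgue_integral_def G_def
    by (rule LIMSEQ_offset[where k = m])
qed

text \<open>
  The two alternative bounds on the absorption term are merged into one: \<open>L \<tau>\<close> is a multiple
  of \<open>\<tau> powr \<gamma>\<close> in the first case and 0 in the second.
\<close>

locale rescaled_limit =
  fixes J :: "'a::euclidean_space \<Rightarrow> real" and \<rho> p c0 :: real and r \<mu> :: "nat \<Rightarrow> real"
    and v :: "nat \<Rightarrow> 'a \<times> real \<Rightarrow> real" and U :: "'a \<times> real \<Rightarrow> real" and G :: "'a set"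
    and \<phi> :: "('a \<Rightarrow> real) \<Rightarrow> real"
  assumes J_radial: "\<And>x y. norm x = norm y \<Longrightarrow> J x = J y" and J_cont: "continuous_on UNIV J"
    and J_nonneg: "\<And>z. 0 \<le> J z" and J_supp: "\<And>z. \<rho> < norm z \<Longrightarrow> J z = 0" and \<rho>: "0 < \<rho>"
    and p: "1 < p" and r_pos: "\<And>n. 0 < r n" and r_lim: "filterlim r at_top sequentially"
    and v_regular: "\<And>n. regular_solution (scaled_kernel J (r n)) (\<mu> n) p (v n)"
    and \<mu>0: "\<And>n. 0 \<le> \<mu> n" and \<mu>_lim: "\<mu> \<longlonglongrightarrow> c0"
    and U_meas: "(\<lambda>z. if 0 < snd z then U z else 0) \<in> borel_measurable borel"
    and G: "AE x in lborel. x \<in> G"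
    and conv: "\<And>Q e. compact Q \<Longrightarrow> Q \<subseteq> UNIV \<times> {0<..} \<Longrightarrow> 0 < e \<Longrightarrow>
      \<forall>\<^sub>F n in sequentially. \<forall>z\<in>Q. fst z \<in> G \<longrightarrow> \<bar>v n z - U z\<bar> < e"
    and mass: "\<And>R. 0 < R \<Longrightarrow> \<exists>C. \<forall>\<tau>>0. \<forall>n. (LINT z:ball 0 R \<times> {0<..<\<tau>}|lborel. v n z) \<le> C * \<tau>"
    and absorption: "\<And>R. 0 < R \<Longrightarrow> \<exists>L. (L \<longlongrightarrow> 0) (at_right 0) \<and> (\<forall>\<tau>>0. \<forall>e>0. \<forall>\<^sub>F n in sequentially.
      \<mu> n * (LINT z:ball 0 R \<times> {0<..<\<tau>}|lborel. v n z powr p) \<le> L \<tau> + e)"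
    and trace: "\<And>\<psi>. test_function_on UNIV \<psi> \<Longrightarrow> (\<lambda>n. LINT x|lborel. v n (x, 0) * \<psi> x) \<longlonglongrightarrow> \<phi> \<psi>"
begin

section \<open>Local bounds and integrability of the limit function\<close>

lemma v_meas: "v n \<in> borel_measurable borel" and v0: "0 \<le> v n z"
  and v_bd: "\<exists>M. \<forall>x. \<forall>t\<le>T. v n (x, t) \<le> M"
  using v_regular[of n] unfolding regular_solution_def by blast+

lemma kernel: "bounded_kernel (scaled_kernel J (r n)) (\<rho> / r n)"
proof (rule bounded_kernel_scaled)
  show "bounded_kernel J \<rho>"
  proof
    show "J (- z) = J z" for z by (rule J_radial) simp
  qed (use J_cont J_supp \<rho> in auto)
qed (rule r_pos)

lemma v_tendsto:
  assumes "x \<in> G" "0 < t" shows "(\<lambda>n. v n (x, t)) \<longlonglongrightarrow> U (x, t)"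
proof (rule tendstoI)
  fix e :: real assume "0 < e"
  have "\<forall>\<^sub>F n in sequentially. \<forall>z\<in>{(x, t)}. fst z \<in> G \<longrightarrow> \<bar>v n z - U z\<bar> < e"
    by (rule conv) (use assms \<open>0 < e\<close> in auto)
  then show "\<forall>\<^sub>F n in sequentially. dist (v n (x, t)) (U (x, t)) < e"
    by eventually_elim (use assms in \<open>auto simp: dist_real_def\<close>)
qed

lemma U_nonneg: "x \<in> G \<Longrightarrow> 0 < t \<Longrightarrow> 0 \<le> U (x, t)"
  by (rule LIMSEQ_le_const[OF v_tendsto]) (use v0 in auto)

lemma G_product: "AE z in lborel. fst z \<in> G" by (rule AE_lborel_fst[OF G])

text \<open>At nonpositive times \<open>U\<close> is arbitrary; on \<open>A\<close> it agrees with
  its Borel extension by 0. The function \<open>h\<close> is the identity in the uses for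
  \<open>U\<close> itself and \<open>c0\<close> times a power in those for the absorption.\<close>

lemma U_set_measurable:
  fixes g :: "'a \<times> real \<Rightarrow> real" and h :: "real \<Rightarrow> real"
  assumes "A \<in> sets borel" "A \<subseteq> UNIV \<times> {0<..}"
    and [measurable]: "g \<in> borel_measurable borel" "h \<in> borel_measurable borel"
  shows "set_borel_measurable lborel A (\<lambda>z. h (U z) * g z)"
proof -
  have [measurable]: "A \<in> sets borel" by fact
  define U0 where "U0 z = (if 0 < snd z then U z else 0)" for z
  have [measurable]: "U0 \<in> borel_measurable borel" using U_meas by (simp add: U0_def[abs_def])
  have "(\<lambda>z. indicator A z *\<^sub>R (h (U z) * g z)) = (\<lambda>z. indicator A z *\<^sub>R (h (U0 z) * g z))"
    using assms(2) by (fastforce simp: indicator_def U0_def)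
  then show ?thesis unfolding set_borel_measurable_def by simp
qed

text \<open>Uniform convergence spreads the bound of a single member: every late \<open>v n\<close>
  is within 1 of \<open>U\<close>, hence within 2 of one fixed \<open>v m\<close>, which is bounded
  up to the largest time in \<open>Q\<close>.\<close>

lemma locally_bounded:
  assumes "compact Q" "Q \<subseteq> UNIV \<times> {0<..}"
  obtains M where "0 \<le> M" "\<forall>\<^sub>F n in sequentially. \<forall>z\<in>Q. fst z \<in> G \<longrightarrow> v n z \<le> M"
proof -
  have ev: "\<forall>\<^sub>F n in sequentially. \<forall>z\<in>Q. fst z \<in> G \<longrightarrow> \<bar>v n z - U z\<bar> < 1"
    using assms by (rule conv) simp
  then obtain m where m: "\<forall>z\<in>Q. fst z \<in> G \<longrightarrow> \<bar>v m z - U z\<bar> < 1"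
    unfolding eventually_sequentially by blast
  have "bounded (snd ` Q)"
    using assms(1) by (intro compact_imp_bounded compact_continuous_image) (auto intro: continuous_intros)
  then obtain T where T: "\<forall>t\<in>snd ` Q. \<bar>t\<bar> \<le> T" unfolding bounded_iff by auto
  obtain M where M: "\<forall>x. \<forall>t\<le>T. v m (x, t) \<le> M" using v_bd by blast
  have "\<forall>\<^sub>F n in sequentially. \<forall>z\<in>Q. fst z \<in> G \<longrightarrow> v n z \<le> max 0 M + 2"
    using ev
  proof (eventually_elim, intro ballI impI)
    fix n z assume n: "\<forall>z\<in>Q. fst z \<in> G \<longrightarrow> \<bar>v n z - U z\<bar> < 1" and z: "z \<in> Q" "fst z \<in> G"
    have "snd z \<le> T" using T z(1) by fastforce
    then have "v m z \<le> M" using M[rule_format, of "snd z" "fst z"] by simp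
    moreover have "\<bar>v n z - U z\<bar> < 1" "\<bar>v m z - U z\<bar> < 1" using n m z by auto
    ultimately show "v n z \<le> max 0 M + 2" by linarith
  qed
  then show ?thesis by (intro that[of "max 0 M + 2"]) auto
qed

lemma U_bounded:
  assumes "compact Q" "Q \<subseteq> UNIV \<times> {0<..}"
  obtains M where "\<And>z. z \<in> Q \<Longrightarrow> fst z \<in> G \<Longrightarrow> \<bar>U z\<bar> \<le> M"
proof -
  obtain M where M: "0 \<le> M" "\<forall>\<^sub>F n in sequentially. \<forall>z\<in>Q. fst z \<in> G \<longrightarrow> v n z \<le> M"
    using assms by (rule locally_bounded)
  have "\<bar>U z\<bar> \<le> M" if z: "z \<in> Q" "fst z \<in> G" for z
  proof -
    have t: "0 < snd z" using z assms by auto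
    have "(\<lambda>n. v n z) \<longlonglongrightarrow> U z" using v_tendsto[OF z(2) t] by simp
    moreover have "\<forall>\<^sub>F n in sequentially. v n z \<le> M" using M(2) by eventually_elim (use z in auto)
    ultimately have "U z \<le> M" by (rule tendsto_upperbound) simp
    moreover have "0 \<le> U z" using U_nonneg[OF z(2) t] by simp
    ultimately show ?thesis by simp
  qed
  then show ?thesis by (rule that)
qed

lemma cylinder:
  "ball (0::'a) R \<times> {0<..<\<tau>::real} \<in> sets borel"
  "ball (0::'a) R \<times> {0<..<\<tau>::real} \<subseteq> UNIV \<times> {0<..}"
  "bounded (ball (0::'a) R \<times> {0<..<\<tau>::real})"
  unfolding borel_prod[symmetric] by (auto intro!: pair_measureI bounded_Times)

lemma v_cylinder_integrable:
  "set_integrable lborel (ball 0 R \<times> {0<..<\<tau>}) (v n)"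
  "set_integrable lborel (ball 0 R \<times> {0<..<\<tau>}) (\<lambda>z. v n z powr p)"
proof -
  obtain M where M: "\<forall>x. \<forall>t\<le>\<tau>. v n (x, t) \<le> M" using v_bd by blast
  show "set_integrable lborel (ball 0 R \<times> {0<..<\<tau>}) (v n)"
    by (rule set_integrable_bounded[OF _ cylinder(1,3), where C = M]) (use M v0 v_meas in auto)
  show "set_integrable lborel (ball 0 R \<times> {0<..<\<tau>}) (\<lambda>z. v n z powr p)"
    by (rule set_integrable_bounded[OF _ cylinder(1,3), where C = "M powr p"])
       (use M v0 v_meas p in \<open>auto intro!: powr_mono2\<close>)
qed

lemma U_integrable:
  assumes "0 < R" "0 < \<tau>"
  shows "set_integrable lborel (ball 0 R \<times> {0<..<\<tau>}) U"
proof -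
  obtain C where C: "\<forall>\<tau>>0. \<forall>n. (LINT z:ball 0 R \<times> {0<..<\<tau>}|lborel. v n z) \<le> C * \<tau>"
    using mass[OF assms(1)] by (rule exE)
  show ?thesis
  proof (rule set_integrable_fatou[where g = v and C = "C * \<tau>"])
    have "set_borel_measurable lborel (ball 0 R \<times> {0<..<\<tau>}) (\<lambda>z. U z * 1)"
      by (rule U_set_measurable[OF cylinder(1,2), where h = "\<lambda>s. s" and g = "\<lambda>_. 1"]) measurable
    then show "set_borel_measurable lborel (ball 0 R \<times> {0<..<\<tau>}) U"
      by (simp only: mult_1_right)
    show "AE z in lborel. z \<in> ball 0 R \<times> {0<..<\<tau>} \<longrightarrow> (\<lambda>n. v n z) \<longlonglongrightarrow> U z"
      using G_product by eventually_elim (auto intro: v_tendsto)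
  qed (use C assms v_cylinder_integrable v0 in auto)
qed

text \<open>The factor \<open>c0\<close> stays inside because \<open>absorption\<close> controls
  only the product of \<open>\<mu> n\<close> and the integral: for \<open>c0 = 0\<close> it does not
  bound the power of \<open>U\<close> up to t = 0. Any fixed slack suffices for Fatou's lemma, here
  1.\<close>

lemma U_powr_integrable:
  assumes "0 < R" "0 < \<tau>"
  shows "set_integrable lborel (ball 0 R \<times> {0<..<\<tau>}) (\<lambda>z. c0 * U z powr p)"
proof -
  obtain L where L: "\<forall>\<tau>>0. \<forall>e>0. \<forall>\<^sub>F n in sequentially.
      \<mu> n * (LINT z:ball 0 R \<times> {0<..<\<tau>}|lborel. v n z powr p) \<le> L \<tau> + e"
    using absorption[OF assms(1)] by (elim exE conjE) (rule that)
  show ?thesis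
  proof (rule set_integrable_fatou[where g = "\<lambda>n z. \<mu> n * v n z powr p" and C = "L \<tau> + 1"])
    have "set_borel_measurable lborel (ball 0 R \<times> {0<..<\<tau>}) (\<lambda>z. c0 * U z powr p * 1)"
      by (rule U_set_measurable[OF cylinder(1,2), where h = "\<lambda>s. c0 * s powr p" and g = "\<lambda>_. 1"]) measurable
    then show "set_borel_measurable lborel (ball 0 R \<times> {0<..<\<tau>}) (\<lambda>z. c0 * U z powr p)"
      by (simp only: mult_1_right)
    show "AE z in lborel. z \<in> ball 0 R \<times> {0<..<\<tau>} \<longrightarrow> (\<lambda>n. \<mu> n * v n z powr p) \<longlonglongrightarrow> c0 * U z powr p"
      using G_product
    proof eventually_elim
      case (elim z)
      show ?case
      proof
        assume "z \<in> ball 0 R \<times> {0<..<\<tau>}"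
        then have "(\<lambda>n. v n z) \<longlonglongrightarrow> U z" using v_tendsto[OF elim, of "snd z"] by auto
        then show "(\<lambda>n. \<mu> n * v n z powr p) \<longlonglongrightarrow> c0 * U z powr p"
          using p v0 by (intro tendsto_mult \<mu>_lim tendsto_powr') auto
      qed
    qed
    show "\<forall>\<^sub>F n in sequentially. (LINT z:ball 0 R \<times> {0<..<\<tau>}|lborel. \<mu> n * v n z powr p) \<le> L \<tau> + 1"
      using L assms by simp
    show "set_integrable lborel (ball 0 R \<times> {0<..<\<tau>}) (\<lambda>z. \<mu> n * v n z powr p)" for n
      by (intro set_integrable_mult_right v_cylinder_integrable)
  qed (use \<mu>0 in auto)
qed

lemma slice_compact: "0 < t \<Longrightarrow> compact (cball (0::'a) R \<times> {t}) \<and> cball (0::'a) R \<times> {t} \<subseteq> UNIV \<times> {0<..}" for t :: real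
  by (auto intro: compact_Times)

lemma U_slice_measurable: "0 < t \<Longrightarrow> (\<lambda>x. U (x, t)) \<in> borel_measurable borel"
  using measurable_compose[OF _ U_meas, of "\<lambda>x. (x, t)" borel] by simp

lemma U_slice_integrable:
  assumes t: "0 < t" shows "set_integrable lborel (ball 0 R) (\<lambda>x. U (x, t))"
proof -
  obtain M where M: "\<And>z. z \<in> cball 0 R \<times> {t} \<Longrightarrow> fst z \<in> G \<Longrightarrow> \<bar>U z\<bar> \<le> M"
    using slice_compact[OF t] by (metis U_bounded)
  have "set_integrable lborel (ball 0 R) (\<lambda>_. M :: real)"
    by (rule set_integrable_bounded[where C = "\<bar>M\<bar>"]) auto
  then show ?thesis
  proof (rule set_integrable_bound)
    show "set_borel_measurable lborel (ball 0 R) (\<lambda>x. U (x, t))"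
      unfolding set_borel_measurable_def
      by (intro borel_measurable_scaleR borel_measurable_indicator) (simp_all add: U_slice_measurable[OF t])
    show "AE x in lborel. x \<in> ball 0 R \<longrightarrow> norm (U (x, t)) \<le> norm M"
      using G by eventually_elim (use M in force)
  qed
qed

end

section \<open>Limit equation and initial trace\<close>

context rescaled_limit
begin

lemma op_tendsto:
  assumes "smooth f" "vanishes_off R f" "0 < e"
  shows "\<forall>\<^sub>F n in sequentially. \<forall>x. \<forall>t\<in>{0..T}.
    \<bar>nonlocal_op (scaled_kernel J (r n)) f x t - diffusivity J * space_laplacian f (x, t)\<bar> \<le> e"
  by (rule eventually_compose_filterlim[OF
      nonlocal_op_tendsto_laplacian[OF J_radial J_cont J_nonneg J_supp \<rho> assms] r_lim])

lemma r_large: "\<forall>\<^sub>F n in sequentially. \<rho> / r n \<le> 1"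
proof -
  have "\<forall>\<^sub>F n in sequentially. \<rho> \<le> r n"
    using r_lim by (simp add: filterlim_at_top)
  then show ?thesis by eventually_elim (use r_pos in \<open>simp add: divide_le_eq_1\<close>)
qed

lemma laplacian_continuous:
  assumes "smooth f" "vanishes_off R f"
  shows "continuous_on UNIV (space_laplacian f)" "vanishes_off R (space_laplacian f)"
proof -
  show "continuous_on UNIV (space_laplacian f)"
    unfolding space_laplacian_def
    by (intro continuous_on_sum smooth_continuous_on smooth_dir_deriv assms)
  have "vanishes_off R (dir_deriv (b, 0) (dir_deriv (b, 0) f))" for b
    by (intro vanishes_off_dir_deriv assms)
  then show "vanishes_off R (space_laplacian f)"
    by (simp add: vanishes_off_def space_laplacian_def)
qed

text \<open>Provides one domain of integration for all late \<open>n\<close>: if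
  \<open>\<rho> / r n \<le> 1\<close>, the closed ball of radius \<open>R + \<rho> / r n\<close>
  lies in the open ball of radius \<open>R + 2\<close>, and open balls are the sets for which
  \<open>mass\<close> and \<open>absorption\<close> are available.\<close>

lemma weak_equation:
  assumes f: "smooth f" "vanishes_off R f" and T: "0 \<le> T" and n: "\<rho> / r n \<le> 1"
  shows "(LINT x|lborel. v n (x, T) * f (x, T)) - (LINT x|lborel. v n (x, 0) * f (x, 0)) =
    (LINT z:ball 0 (R + 2) \<times> {0<..<T}|lborel.
      v n z * (time_deriv f z + nonlocal_op (scaled_kernel J (r n)) f (fst z) (snd z)) - \<mu> n * v n z powr p * f z)"
proof -
  interpret bounded_kernel "scaled_kernel J (r n)" "\<rho> / r n" by (rule kernel)
  let ?g = "\<lambda>z. v n z * (time_deriv f z + nonlocal_op (scaled_kernel J (r n)) f (fst z) (snd z)) - \<mu> n * v n z powr p * f z"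
  let ?S = "cball (0::'a) (R + \<rho> / r n)"
  have "vanishes_off R (time_deriv f)"
    unfolding time_deriv_def by (intro vanishes_off_dir_deriv f)
  then have off: "?g (x, t) = 0" if "x \<notin> ?S" for x t
  proof -
    have "R + \<rho> / r n < norm x" using that by (simp add: not_le)
    moreover then have "x \<notin> cball 0 R" using \<rho> by auto
    ultimately show ?thesis
      using f(2) \<open>vanishes_off R (time_deriv f)\<close> nonlocal_op_support[OF f(2)] by (simp add: vanishes_off_def)
  qed
  have "(LINT z:?S \<times> {0<..<T}|lborel. ?g z) = (LINT z:ball 0 (R + 2) \<times> {0<..<T}|lborel. ?g z)"
    unfolding set_lebesgue_integral_def
  proof (rule Bochner_Integration.integral_cong[OF refl])
    fix z :: "'a \<times> real"
    show "indicator (?S \<times> {0<..<T}) z *\<^sub>R ?g z = indicator (ball 0 (R + 2) \<times> {0<..<T}) z *\<^sub>R ?g z"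
    proof (cases "fst z \<in> ?S")
      case True
      then have "fst z \<in> ball 0 (R + 2)" using n by auto
      then show ?thesis using True by (cases z) (simp add: indicator_def)
    next
      case False
      then have "?g z = 0" using off[OF False, of "snd z"] unfolding prod.collapse by blast
      then show ?thesis by simp
    qed
  qed
  then show ?thesis using weak_formulation[OF v_regular[of n] _ f T] p by simp
qed

text \<open>The support of \<open>\<psi>\<close> starts at a positive time, after which the
  \<open>v n\<close> are eventually bounded almost everywhere on the relevant box. Bounded
  convergence thus passes to the limit in the weak equations, all of which have vanishing boundary
  terms.\<close>

lemma U_weak:
  assumes \<psi>: "test_function_on (UNIV \<times> {0<..}) \<psi>"
  shows "(LINT z|lborel. U z * (- time_deriv \<psi> z - diffusivity J * space_laplacian \<psi> z)) =
    (LINT z|lborel. - c0 * U z powr p * \<psi> z)"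
proof -
  define a where "a = diffusivity J"
  define S where "S = supp \<psi>"
  have smooth: "smooth \<psi>" and S: "compact S" "S \<subseteq> UNIV \<times> {0<..}"
    using \<psi> by (auto simp: test_function_on_def S_def)
  have off: "\<psi> z = 0" if "z \<notin> S" for z
    using that closure_subset[of "{x. \<psi> x \<noteq> 0}"] unfolding S_def supp_def by auto
  have "open (- S)" using S(1) by (simp add: compact_imp_closed open_Compl)
  then have d_off: "dir_deriv w \<psi> z = 0" if "z \<notin> S" for w z
    by (rule dir_deriv_zero_on_open) (use off that in auto)
  then have dd_off: "dir_deriv w' (dir_deriv w \<psi>) z = 0" if "z \<notin> S" for w w' z
    by (rule_tac dir_deriv_zero_on_open[OF \<open>open (- S)\<close>]) (use that in auto)
  \<comment> \<open>The support may be empty. Adding a point with positive time makes the extremal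
    times exist, keeps the earliest one positive, and forces the radius \<open>R\<close> to be
    nonnegative.\<close>
  let ?S = "insert (0, 1) S"
  have comp: "compact ?S" using S(1) by (rule compact_insert)
  have "bounded (fst ` ?S)"
    by (intro compact_imp_bounded compact_continuous_image comp) (auto intro: continuous_intros)
  then obtain R where R: "\<forall>x\<in>fst ` ?S. norm x \<le> R" unfolding bounded_iff by blast
  have csnd: "compact (snd ` ?S)"
    by (intro compact_continuous_image comp) (auto intro: continuous_intros)
  obtain \<sigma> where \<sigma>: "\<sigma> \<in> snd ` ?S" "\<And>t. t \<in> snd ` ?S \<Longrightarrow> \<sigma> \<le> t"
    using compact_attains_inf[OF csnd] by auto
  obtain T0 where T0: "T0 \<in> snd ` ?S" "\<And>t. t \<in> snd ` ?S \<Longrightarrow> t \<le> T0"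
    using compact_attains_sup[OF csnd] by auto
  have \<sigma>0: "0 < \<sigma>" using \<sigma>(1) S(2) by auto
  \<comment> \<open>The added 1 puts the final time strictly beyond the support, so the boundary
    term at \<open>T\<close> vanishes.\<close>
  define T where "T = T0 + 1"
  have T: "0 < T" using T0(2)[of 1] by (simp add: T_def)
  have S_box: "norm x \<le> R" "\<sigma> \<le> t" "t < T" if "(x, t) \<in> S" for x t
  proof -
    have x: "x \<in> fst ` ?S" and t: "t \<in> snd ` ?S" using that by force+
    show "norm x \<le> R" using R x by blast
    show "\<sigma> \<le> t" by (rule \<sigma>(2)[OF t])
    show "t < T" using T0(2)[OF t] by (simp add: T_def)
  qed
  have van: "vanishes_off R \<psi>"
    unfolding vanishes_off_def using off S_box by fastforce
  define A where "A = ball (0::'a) (R + 2) \<times> {0<..<T}"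
  note A = cylinder[where R = "R + 2" and \<tau> = T, folded A_def]
  have SA: "z \<in> A" if "z \<in> S" for z
    using that S_box[of "fst z" "snd z"] \<sigma>0 by (cases z) (auto simp: A_def)
  define H where "H z = time_deriv \<psi> z + a * space_laplacian \<psi> z" for z
  define Hn where "Hn n z = time_deriv \<psi> z + nonlocal_op (scaled_kernel J (r n)) \<psi> (fst z) (snd z)" for n z
  have t_cont: "continuous_on UNIV (time_deriv \<psi>)"
    unfolding time_deriv_def by (intro smooth_continuous_on smooth_dir_deriv smooth)
  have t_van: "vanishes_off R (time_deriv \<psi>)"
    unfolding time_deriv_def by (intro vanishes_off_dir_deriv van)
  have H_cont: "continuous_on UNIV H"
    unfolding H_def[abs_def] by (intro continuous_intros t_cont laplacian_continuous[OF smooth van])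
  have H_van: "vanishes_off R H"
    using t_van laplacian_continuous(2)[OF smooth van] by (simp add: H_def vanishes_off_def)
  have \<psi>_cont: "continuous_on UNIV \<psi>" by (rule smooth_continuous_on[OF smooth])
  have \<psi>_meas [measurable]: "\<psi> \<in> borel_measurable borel" and H_meas [measurable]: "H \<in> borel_measurable borel"
    and t_meas [measurable]: "time_deriv \<psi> \<in> borel_measurable borel"
    using \<psi>_cont H_cont t_cont by (auto intro: borel_measurable_continuous_onI)
  obtain CH where CH: "0 \<le> CH" "\<And>x t. t \<in> {0..T} \<Longrightarrow> \<bar>H (x, t)\<bar> \<le> CH"
    using vanishes_off_bounded[OF H_cont H_van] by blast
  obtain C\<psi> where C\<psi>: "0 \<le> C\<psi>" "\<And>x t. t \<in> {0..T} \<Longrightarrow> \<bar>\<psi> (x, t)\<bar> \<le> C\<psi>"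
    using vanishes_off_bounded[OF \<psi>_cont van] by blast
  define g where "g n z = v n z * Hn n z - \<mu> n * v n z powr p * \<psi> z" for n z
  define h where "h z = U z * H z - c0 * U z powr p * \<psi> z" for z
  have Hn_lim: "\<forall>\<^sub>F n in sequentially. \<forall>x. \<forall>t\<in>{0..T}. \<bar>Hn n (x, t) - H (x, t)\<bar> \<le> e" if "0 < e" for e
    using op_tendsto[OF smooth van that, of T] by (simp add: Hn_def H_def a_def)
  obtain B where B: "\<And>n. \<bar>\<mu> n\<bar> \<le> B"
    using convergent_imp_Bseq[OF convergentI[OF \<mu>_lim]] unfolding Bseq_def by auto
  \<comment> \<open>The cylinder \<open>A\<close> reaches t = 0, where no uniform bound is known;
    \<open>Q\<close> is the part of it from time \<open>\<sigma>\<close> on, enlarged to a compact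
    set.\<close>
  define Q where "Q = cball (0::'a) (R + 2) \<times> {\<sigma>..T}"
  have "compact Q" "Q \<subseteq> UNIV \<times> {0<..}"
    using \<sigma>0 by (auto simp: Q_def intro: compact_Times)
  then obtain M where M: "0 \<le> M" "\<forall>\<^sub>F n in sequentially. \<forall>z\<in>Q. fst z \<in> G \<longrightarrow> v n z \<le> M"
    by (rule locally_bounded)
  \<comment> \<open>The operator jumps in space only. Before time \<open>\<sigma>\<close> the whole
    slice of \<open>\<psi>\<close> is 0, hence so is its nonlocal term, and possible growth of
    \<open>v n\<close> near t = 0 does no harm.\<close>
  have early: "g n (x, t) = 0" if "t < \<sigma>" for n x t
  proof -
    have "(y, t) \<notin> S" for y using S_box[of y t] that by auto
    then show ?thesis using off d_off by (simp add: g_def Hn_def time_deriv_def nonlocal_op_def)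
  qed
  have g_bound: "\<forall>\<^sub>F n in sequentially. AE z in lborel. z \<in> A \<longrightarrow> \<bar>g n z\<bar> \<le> M * (CH + 1) + B * M powr p * C\<psi>"
    using Hn_lim[OF zero_less_one] M(2)
  proof eventually_elim
    case (elim n)
    show ?case
      using G_product
    proof (eventually_elim, intro impI)
      fix z :: "'a \<times> real" assume zG: "fst z \<in> G" and zA: "z \<in> A"
      obtain x t where z: "z = (x, t)" by (cases z)
      have t: "t \<in> {0..T}" using zA by (auto simp: z A_def)
      have B0: "0 \<le> B" using B[of 0] by linarith
      show "\<bar>g n z\<bar> \<le> M * (CH + 1) + B * M powr p * C\<psi>"
      proof (cases "t < \<sigma>")
        case True
        then show ?thesis using M(1) CH(1) C\<psi>(1) B0 by (simp add: z early)
      next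
        case False
        then have "z \<in> Q" using zA by (auto simp: z A_def Q_def)
        then have vM: "v n z \<le> M" using elim(2) zG by blast
        have "\<bar>Hn n (x, t) - H (x, t)\<bar> \<le> 1" using elim(1) t by blast
        then have "\<bar>Hn n z\<bar> \<le> CH + 1" using CH(2)[OF t, of x] unfolding z by linarith
        then have "\<bar>v n z * Hn n z\<bar> \<le> M * (CH + 1)"
          unfolding abs_mult using vM v0[of n z] M(1) by (intro mult_mono) auto
        moreover have "v n z powr p \<le> M powr p"
          using vM v0[of n z] p by (intro powr_mono2) auto
        then have "\<bar>\<mu> n * v n z powr p * \<psi> z\<bar> \<le> B * M powr p * C\<psi>"
          unfolding abs_mult using B[of n] C\<psi>(2)[OF t, of x] B0 by (intro mult_mono) (auto simp: z)
        ultimately show ?thesis unfolding g_def by linarith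
      qed
    qed
  qed
  have g_meas: "g n \<in> borel_measurable borel" for n
  proof -
    note [measurable] = v_meas[of n] bounded_kernel.nonlocal_op_measurable[OF kernel[of n] \<psi>_meas]
    show ?thesis unfolding g_def[abs_def] Hn_def by measurable
  qed
  have h_meas: "set_borel_measurable lborel A h"
  proof -
    have "set_borel_measurable lborel A (\<lambda>z. U z * H z)"
      by (rule U_set_measurable[OF A(1,2), where h = "\<lambda>s. s"]) measurable
    moreover have "set_borel_measurable lborel A (\<lambda>z. c0 * U z powr p * \<psi> z)"
      by (rule U_set_measurable[OF A(1,2), where h = "\<lambda>s. c0 * s powr p"]) measurable
    ultimately show ?thesis
      unfolding set_borel_measurable_def h_def scaleR_diff_right by (rule borel_measurable_diff)
  qed
  have g_lim: "AE z in lborel. z \<in> A \<longrightarrow> (\<lambda>n. g n z) \<longlonglongrightarrow> h z"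
    using G_product
  proof (eventually_elim, intro impI)
    fix z :: "'a \<times> real" assume zG: "fst z \<in> G" and zA: "z \<in> A"
    have t: "0 < snd z" "snd z \<in> {0..T}" using zA by (auto simp: A_def)
    have vU: "(\<lambda>n. v n z) \<longlonglongrightarrow> U z" using v_tendsto[OF zG t(1)] by simp
    have "(\<lambda>n. Hn n z) \<longlonglongrightarrow> H z"
    proof (rule tendstoI)
      fix e :: real assume e: "0 < e"
      then have "0 < e / 2" by simp
      from Hn_lim[OF this] show "\<forall>\<^sub>F n in sequentially. dist (Hn n z) (H z) < e"
      proof eventually_elim
        case (elim n)
        have "\<bar>Hn n (fst z, snd z) - H (fst z, snd z)\<bar> \<le> e / 2" using elim t(2) by blast
        then show ?case using e by (simp add: dist_real_def)
      qed
    qed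
    then show "(\<lambda>n. g n z) \<longlonglongrightarrow> h z"
      unfolding g_def h_def using p v0
      by (intro tendsto_diff tendsto_mult \<mu>_lim vU tendsto_const tendsto_powr') auto
  qed
  have "(\<lambda>n. LINT z:A|lborel. g n z) \<longlonglongrightarrow> (LINT z:A|lborel. h z)"
    by (rule set_bounded_convergence(2)[OF A(1,3) g_meas g_bound h_meas g_lim])
  moreover have "\<forall>\<^sub>F n in sequentially. (LINT z:A|lborel. g n z) = 0"
    using r_large
  proof eventually_elim
    case (elim n)
    have "(x, T) \<notin> S" "(x, 0) \<notin> S" for x using S_box(3)[of x T] S_box(2)[of x 0] \<sigma>0 by auto
    then show ?case
      using weak_equation[OF smooth van less_imp_le[OF T] elim]
      unfolding g_def Hn_def A_def by (simp add: off)
  qed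
  then have "(\<lambda>n. LINT z:A|lborel. g n z) \<longlonglongrightarrow> 0" by (rule tendsto_eventually)
  ultimately have h0: "(LINT z:A|lborel. h z) = 0" by (rule LIMSEQ_unique)
  \<comment> \<open>Splitting the integral of \<open>h\<close> into its two parts requires each part
    to be integrable on its own.\<close>
  have bound_int: "set_integrable lborel A (\<lambda>z. F z * k z)"
    if F: "set_integrable lborel A F" and k: "k \<in> borel_measurable borel"
      and kb: "\<And>x t. t \<in> {0..T} \<Longrightarrow> \<bar>k (x, t)\<bar> \<le> C" and "0 \<le> C" for F k :: "'a \<times> real \<Rightarrow> real" and C
  proof (rule set_integrable_bound)
    show "set_integrable lborel A (\<lambda>z. C * F z)" using F by simp
    have "(\<lambda>z. indicator A z *\<^sub>R F z) \<in> borel_measurable lborel"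
      using F unfolding set_integrable_def by (rule borel_measurable_integrable)
    then have "(\<lambda>z. (indicator A z *\<^sub>R F z) * k z) \<in> borel_measurable lborel"
      by (rule borel_measurable_times) (use k in simp)
    then show "set_borel_measurable lborel A (\<lambda>z. F z * k z)"
      by (simp add: set_borel_measurable_def mult.assoc)
    have "norm (F z * k z) \<le> norm (C * F z)" if "z \<in> A" for z
    proof -
      have "snd z \<in> {0..T}" using that by (auto simp: A_def)
      then have "\<bar>k z\<bar> \<le> C" using kb[of "snd z" "fst z"] by simp
      then have "\<bar>F z\<bar> * \<bar>k z\<bar> \<le> \<bar>F z\<bar> * C" by (rule mult_left_mono) simp
      then show ?thesis using \<open>0 \<le> C\<close> by (simp add: abs_mult mult.commute)
    qed
    then show "AE z in lborel. z \<in> A \<longrightarrow> norm (F z * k z) \<le> norm (C * F z)" by simp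
  qed
  have R0: "0 < R + 2" using R by force
  have i1: "set_integrable lborel A (\<lambda>z. U z * H z)"
    using U_integrable[OF R0 T] CH by (intro bound_int[where C = CH]) (auto simp: A_def)
  have i2: "set_integrable lborel A (\<lambda>z. c0 * U z powr p * \<psi> z)"
    using U_powr_integrable[OF R0 T] C\<psi>
    by (intro bound_int[where F = "\<lambda>z. c0 * U z powr p" and k = \<psi> and C = C\<psi>]) (auto simp: A_def)
  have eq: "(LINT z:A|lborel. U z * H z) = (LINT z:A|lborel. c0 * U z powr p * \<psi> z)"
    using set_integral_diff(2)[OF i1 i2] h0 by (simp add: h_def)
  \<comment> \<open>Off the support every integrand is 0, whatever \<open>U\<close> may be at
    nonpositive times, so integrals over the cylinder and over all of space-time agree.\<close>
  have ext: "(LINT z:A|lborel. F z) = (LINT z|lborel. F z)" if "\<And>z. z \<notin> S \<Longrightarrow> F z = 0" for F :: "'a \<times> real \<Rightarrow> real"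
    unfolding set_lebesgue_integral_def
  proof (rule Bochner_Integration.integral_cong[OF refl])
    fix z show "indicator A z *\<^sub>R F z = F z"
      using that SA by (cases "z \<in> S") auto
  qed
  have "(LINT z|lborel. U z * (- time_deriv \<psi> z - a * space_laplacian \<psi> z)) = (LINT z|lborel. - (U z * H z))"
    by (simp add: H_def algebra_simps)
  also have "\<dots> = - (LINT z:A|lborel. U z * H z)"
    using d_off dd_off by (subst ext) (simp_all add: H_def time_deriv_def space_laplacian_def)
  also have "\<dots> = - (LINT z|lborel. c0 * U z powr p * \<psi> z)"
    unfolding eq by (subst ext) (simp_all add: off)
  also have "\<dots> = (LINT z|lborel. - c0 * U z powr p * \<psi> z)" by simp
  finally show ?thesis by (simp only: a_def)
qed

text \<open>For a test function constant in time, the weak equation expresses the change of the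
  tested \<open>v n\<close> between times 0 and \<open>\<tau>\<close> through the operator and the
  absorption alone. The mass bound makes the first O(\<tau>), and \<open>absorption\<close> controls
  the second. Hence the distance to the initial datum is small with \<open>\<tau>\<close>, uniformly
  in late \<open>n\<close>.\<close>

lemma U_trace:
  assumes \<psi>: "test_function_on UNIV \<psi>"
  shows "((\<lambda>t. LINT x|lborel. U (x, t) * \<psi> x) \<longlongrightarrow> \<phi> \<psi>) (at_right 0)"
proof -
  define f where "f z = \<psi> (fst z)" for z :: "'a \<times> real"
  have \<psi>_smooth: "smooth \<psi>" and comp: "compact (supp \<psi>)"
    using \<psi> by (auto simp: test_function_on_def)
  have smooth: "smooth f" unfolding f_def[abs_def] by (rule smooth_compose_fst[OF \<psi>_smooth])
  obtain R where R: "0 < R" "\<And>x. x \<in> supp \<psi> \<Longrightarrow> norm x \<le> R"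
    using compact_imp_bounded[OF comp] unfolding bounded_pos by blast
  have off: "\<psi> x = 0" if "x \<notin> cball 0 R" for x
    using that closure_subset[of "{x. \<psi> x \<noteq> 0}"] R(2)[of x] unfolding supp_def by auto
  have van: "vanishes_off R f" by (simp add: vanishes_off_def f_def off)
  have \<psi>_meas [measurable]: "\<psi> \<in> borel_measurable borel"
    by (intro borel_measurable_continuous_onI smooth_continuous_on \<psi>_smooth)
  have f_cont: "continuous_on UNIV f" by (rule smooth_continuous_on[OF smooth])
  then have f_meas [measurable]: "f \<in> borel_measurable borel" by (rule borel_measurable_continuous_onI)
  obtain C\<psi> where C\<psi>: "0 \<le> C\<psi>" "\<And>x t. t \<in> {0..1} \<Longrightarrow> \<bar>f (x, t)\<bar> \<le> C\<psi>"
    using vanishes_off_bounded[OF f_cont van] by blast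
  have \<psi>_le: "\<bar>\<psi> x\<bar> \<le> C\<psi>" for x using C\<psi>(2)[of 0 x] by (simp add: f_def)
  have "time_deriv f (x, t) = 0" for x t
  proof -
    have "((\<lambda>t. f (x, t)) has_real_derivative 0) (at t)" by (simp add: f_def)
    with smooth_time_derivative[OF smooth, of x t] show ?thesis by (rule DERIV_unique)
  qed
  then have t0: "time_deriv f z = 0" for z by (metis surj_pair)
  obtain CL where CL: "0 \<le> CL" "\<And>x t. t \<in> {0..1} \<Longrightarrow> \<bar>space_laplacian f (x, t)\<bar> \<le> CL"
    using vanishes_off_bounded[OF laplacian_continuous[OF smooth van]] by blast
  \<comment> \<open>Bounds the nonlocal term for late \<open>n\<close>: the supremum of the limiting
    Laplacian term plus a tolerance of 1.\<close>
  define S where "S = \<bar>diffusivity J\<bar> * CL + 1"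
  have S0: "0 \<le> S" using CL(1) by (simp add: S_def)
  have op_le: "\<forall>\<^sub>F n in sequentially. \<forall>x. \<forall>t\<in>{0..1}. \<bar>nonlocal_op (scaled_kernel J (r n)) f x t\<bar> \<le> S"
    using op_tendsto[OF smooth van zero_less_one, of 1]
  proof eventually_elim
    case (elim n)
    show ?case
    proof (intro allI ballI)
      fix x :: 'a and t :: real assume t: "t \<in> {0..1}"
      have "\<bar>diffusivity J * space_laplacian f (x, t)\<bar> \<le> \<bar>diffusivity J\<bar> * CL"
        unfolding abs_mult using CL t by (intro mult_left_mono) auto
      moreover have "\<bar>nonlocal_op (scaled_kernel J (r n)) f x t - diffusivity J * space_laplacian f (x, t)\<bar> \<le> 1"
        using elim t by blast
      ultimately show "\<bar>nonlocal_op (scaled_kernel J (r n)) f x t\<bar> \<le> S" unfolding S_def by linarith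
    qed
  qed
  have R2: "0 < R + 2" using R(1) by simp
  obtain C where C: "\<forall>\<tau>>0. \<forall>n. (LINT z:ball 0 (R + 2) \<times> {0<..<\<tau>}|lborel. v n z) \<le> C * \<tau>"
    using mass[OF R2] by (rule exE)
  note C = C[rule_format]
  obtain L where L: "(L \<longlongrightarrow> 0) (at_right 0)" and L_bound: "\<forall>\<tau>>0. \<forall>e>0. \<forall>\<^sub>F n in sequentially.
      \<mu> n * (LINT z:ball 0 (R + 2) \<times> {0<..<\<tau>}|lborel. v n z powr p) \<le> L \<tau> + e"
    using absorption[OF R2] by (elim exE conjE) (rule that)
  note L_bound = L_bound[rule_format]
  \<comment> \<open>The slack in \<open>absorption\<close> is chosen to be \<open>\<tau>\<close>
    itself, so that it disappears together with the other terms as \<open>\<tau>\<close> tends to 0.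
    The limit in \<open>n\<close> is taken here, with \<open>\<tau>\<close> fixed.\<close>
  have est: "\<bar>(LINT x|lborel. U (x, \<tau>) * \<psi> x) - \<phi> \<psi>\<bar> \<le> S * (C * \<tau>) + C\<psi> * (L \<tau> + \<tau>)"
    if \<tau>: "\<tau> \<in> {0<..<1}" for \<tau>
  proof -
    have \<tau>0: "0 < \<tau>" and \<tau>1: "\<tau> < 1" using \<tau> by auto
    define A where "A = ball (0::'a) (R + 2) \<times> {0<..<\<tau>}"
    note A = cylinder[where R = "R + 2" and \<tau> = \<tau>, folded A_def]
    have "\<forall>\<^sub>F n in sequentially. \<bar>(LINT x|lborel. v n (x, \<tau>) * \<psi> x) - (LINT x|lborel. v n (x, 0) * \<psi> x)\<bar>
        \<le> S * (C * \<tau>) + C\<psi> * (L \<tau> + \<tau>)"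
      using r_large op_le L_bound[OF \<tau>0 \<tau>0]
    proof eventually_elim
      case (elim n)
      define g where "g z = v n z * nonlocal_op (scaled_kernel J (r n)) f (fst z) (snd z) - \<mu> n * v n z powr p * f z" for z
      define D where "D z = S * v n z + C\<psi> * (\<mu> n * v n z powr p)" for z
      have vi: "set_integrable lborel A (\<lambda>z. S * v n z)" "set_integrable lborel A (\<lambda>z. C\<psi> * (\<mu> n * v n z powr p))"
        using v_cylinder_integrable[of "R + 2" \<tau> n] by (simp_all add: A_def)
      have D_int: "set_integrable lborel A D"
        unfolding D_def using vi by (rule set_integral_add(1))
      have gD: "\<bar>g z\<bar> \<le> D z" if "z \<in> A" for z
      proof -
        obtain x t where z: "z = (x, t)" by (cases z)
        have t: "t \<in> {0..1}" using that \<tau>1 by (auto simp: z A_def)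
        have "\<bar>nonlocal_op (scaled_kernel J (r n)) f x t\<bar> \<le> S" using elim(2) t by blast
        then have "v n z * \<bar>nonlocal_op (scaled_kernel J (r n)) f x t\<bar> \<le> v n z * S"
          by (rule mult_left_mono) (rule v0)
        then have "\<bar>v n z * nonlocal_op (scaled_kernel J (r n)) f x t\<bar> \<le> S * v n z"
          by (simp only: abs_mult abs_of_nonneg[OF v0] mult.commute)
        moreover have "\<mu> n * v n z powr p * \<bar>f z\<bar> \<le> \<mu> n * v n z powr p * C\<psi>"
          using \<mu>0[of n] C\<psi>(2)[OF t, of x] by (intro mult_left_mono) (simp_all add: z)
        then have "\<bar>\<mu> n * v n z powr p * f z\<bar> \<le> C\<psi> * (\<mu> n * v n z powr p)"
          using \<mu>0[of n] by (simp add: abs_mult mult_ac)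
        ultimately show ?thesis unfolding g_def D_def z fst_conv snd_conv by linarith
      qed
      have g_meas: "g \<in> borel_measurable borel"
      proof -
        note [measurable] = v_meas[of n] bounded_kernel.nonlocal_op_measurable[OF kernel[of n] f_meas]
        show ?thesis unfolding g_def[abs_def] by measurable
      qed
      have "set_borel_measurable lborel A g"
        unfolding set_borel_measurable_def
        by (intro borel_measurable_scaleR borel_measurable_indicator) (use g_meas A(1) in auto)
      moreover have "AE z in lborel. z \<in> A \<longrightarrow> norm (g z) \<le> norm (D z)"
        using gD by (intro AE_I2 impI) (force intro: order_trans[OF _ abs_ge_self])
      ultimately have g_int: "set_integrable lborel A g"
        by (rule set_integrable_bound[OF D_int])
      have "\<bar>LINT z:A|lborel. g z\<bar> \<le> (LINT z:A|lborel. \<bar>g z\<bar>)"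
        using set_integral_norm_bound[OF g_int] by simp
      also have "\<dots> \<le> (LINT z:A|lborel. D z)"
        by (rule set_integral_mono[OF set_integrable_abs[OF g_int] D_int gD])
      also have "\<dots> = S * (LINT z:A|lborel. v n z) + C\<psi> * (\<mu> n * (LINT z:A|lborel. v n z powr p))"
        unfolding D_def set_integral_add(2)[OF vi] by simp
      also have "\<dots> \<le> S * (C * \<tau>) + C\<psi> * (L \<tau> + \<tau>)"
        using C[OF \<tau>0, of n] elim(3) S0 C\<psi>(1) by (intro add_mono mult_left_mono) (simp_all add: A_def)
      finally show ?case
        using weak_equation[OF smooth van less_imp_le[OF \<tau>0] elim(1)] by (simp add: t0 g_def A_def f_def)
    qed
    \<comment> \<open>At a fixed positive time the slice over the support of \<open>\<psi>\<close>
      is compact, so the eventual local bound supplies domination.\<close>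
    moreover have "(\<lambda>n. LINT x|lborel. v n (x, \<tau>) * \<psi> x) \<longlonglongrightarrow> (LINT x|lborel. U (x, \<tau>) * \<psi> x)"
    proof -
      obtain M where M: "0 \<le> M" "\<forall>\<^sub>F n in sequentially. \<forall>z\<in>cball 0 R \<times> {\<tau>}. fst z \<in> G \<longrightarrow> v n z \<le> M"
        using slice_compact[OF \<tau>0, of R] locally_bounded[of "cball 0 R \<times> {\<tau>}"] by blast
      have "(\<lambda>n. LINT x:cball 0 R|lborel. v n (x, \<tau>) * \<psi> x) \<longlonglongrightarrow> (LINT x:cball 0 R|lborel. U (x, \<tau>) * \<psi> x)"
      proof (rule set_bounded_convergence(2))
        show "cball (0::'a) R \<in> sets borel" "bounded (cball (0::'a) R)" by auto
        have "(\<lambda>x. v n (x, \<tau>)) \<in> borel_measurable borel" for n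
          using measurable_compose[OF _ v_meas[of n], of "\<lambda>y. (y, \<tau>)" borel] by simp
        then show "(\<lambda>x. v n (x, \<tau>) * \<psi> x) \<in> borel_measurable borel" for n
          by (rule borel_measurable_times) measurable
        show "set_borel_measurable lborel (cball 0 R) (\<lambda>x. U (x, \<tau>) * \<psi> x)"
          unfolding set_borel_measurable_def
          by (intro borel_measurable_scaleR borel_measurable_indicator borel_measurable_times)
             (simp_all add: U_slice_measurable[OF \<tau>0])
        show "AE x in lborel. x \<in> cball 0 R \<longrightarrow> (\<lambda>n. v n (x, \<tau>) * \<psi> x) \<longlonglongrightarrow> U (x, \<tau>) * \<psi> x"
          using G by eventually_elim (auto intro!: tendsto_mult v_tendsto \<tau>0)
        show "\<forall>\<^sub>F n in sequentially. AE x in lborel. x \<in> cball 0 R \<longrightarrow> \<bar>v n (x, \<tau>) * \<psi> x\<bar> \<le> M * C\<psi>"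
          using M(2)
        proof eventually_elim
          case (elim n)
          show ?case
            using G
          proof (eventually_elim, intro impI)
            fix x assume x: "x \<in> G" "x \<in> cball 0 R"
            have "v n (x, \<tau>) \<le> M" using elim x by auto
            then show "\<bar>v n (x, \<tau>) * \<psi> x\<bar> \<le> M * C\<psi>"
              unfolding abs_mult using v0[of n "(x, \<tau>)"] \<psi>_le M(1) by (intro mult_mono) auto
          qed
        qed
      qed
      moreover have "(LINT x:cball 0 R|lborel. F x * \<psi> x) = (LINT x|lborel. F x * \<psi> x)" for F :: "'a \<Rightarrow> real"
        unfolding set_lebesgue_integral_def
      proof (rule Bochner_Integration.integral_cong[OF refl])
        fix x show "indicator (cball 0 R) x *\<^sub>R (F x * \<psi> x) = F x * \<psi> x"
          using off[of x] by (cases "x \<in> cball 0 R") simp_all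
      qed
      ultimately show ?thesis by simp
    qed
    then have "(\<lambda>n. \<bar>(LINT x|lborel. v n (x, \<tau>) * \<psi> x) - (LINT x|lborel. v n (x, 0) * \<psi> x)\<bar>)
        \<longlonglongrightarrow> \<bar>(LINT x|lborel. U (x, \<tau>) * \<psi> x) - \<phi> \<psi>\<bar>"
      by (intro tendsto_rabs tendsto_diff trace[OF \<psi>])
    ultimately show ?thesis by (intro tendsto_upperbound[OF _ _ sequentially_bot])
  qed
  have "((\<lambda>\<tau>. S * (C * \<tau>) + C\<psi> * (L \<tau> + \<tau>)) \<longlongrightarrow> S * (C * 0) + C\<psi> * (0 + 0)) (at_right 0)"
    by (intro tendsto_intros L)
  then have lim0: "((\<lambda>\<tau>. S * (C * \<tau>) + C\<psi> * (L \<tau> + \<tau>)) \<longlongrightarrow> 0) (at_right 0)" by simp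
  have "\<forall>\<^sub>F \<tau> in at_right 0. norm ((LINT x|lborel. U (x, \<tau>) * \<psi> x) - \<phi> \<psi>) \<le> S * (C * \<tau>) + C\<psi> * (L \<tau> + \<tau>)"
    using eventually_at_right_real[OF zero_less_one] by eventually_elim (use est in simp)
  then have "((\<lambda>\<tau>. (LINT x|lborel. U (x, \<tau>) * \<psi> x) - \<phi> \<psi>) \<longlongrightarrow> 0) (at_right 0)"
    using lim0 by (rule Lim_null_comparison)
  then show ?thesis by (rule LIM_zero_cancel)
qed

lemma U_limit_solution: "limit_solution (diffusivity J) c0 p \<phi> (\<lambda>x t. U (x, t))"
  unfolding limit_solution_def tendsto_distr_def
proof (intro conjI allI impI)
  show "AE x in lborel. \<forall>t>0. 0 \<le> U (x, t)"
    using G by eventually_elim (auto intro: U_nonneg)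
qed (use U_integrable U_powr_integrable U_slice_integrable U_weak U_trace in \<open>simp_all add: case_prod_unfold\<close>)

end

section \<open>From the nonlocal problem to the abstract limit\<close>

text \<open>Rules out the default value 0 of a division by 0. The lower bound near the origin gives
  positive mass to some small ball, and the mass of balls is monotone in the radius because
  \<open>u0\<close> is nonnegative and locally integrable.\<close>

lemma scale_f_pos:
  fixes u0 :: "'a::euclidean_space \<Rightarrow> real"
  assumes [measurable]: "u0 \<in> borel_measurable borel" and bd: "\<exists>M. AE x in lborel. u0 x \<le> M"
    and nonneg: "AE x in lborel. 0 \<le> u0 x" and \<kappa>: "0 < \<kappa>"
    and origin: "\<forall>\<^sub>F r in at_right 0. \<kappa> * r ^ DIM('a) \<le> (LINT x:ball 0 r|lborel. u0 x)"
    and s: "0 < s"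
  shows "0 < scale_f u0 s"
proof -
  obtain M where M: "AE x in lborel. u0 x \<le> M" using bd by (rule exE)
  have int: "integrable lborel (\<lambda>x. indicator (ball 0 R) x *\<^sub>R u0 x)" for R
  proof (rule integrableI_bounded_set_indicator)
    show "AE x in lborel. x \<in> ball 0 R \<longrightarrow> norm (u0 x) \<le> M"
      using M nonneg by eventually_elim simp
  qed (use emeasure_bounded_finite[OF bounded_ball] in auto)
  have "\<forall>\<^sub>F r in at_right 0. \<kappa> * r ^ DIM('a) \<le> (LINT x:ball 0 r|lborel. u0 x) \<and> r \<in> {0<..<s}"
    using origin eventually_at_right_real[OF s] by eventually_elim simp
  \<comment> \<open>The lower bound is known for small radii only, so a radius below
    \<open>s\<close> is picked where it holds.\<close>
  then obtain q where q: "\<kappa> * q ^ DIM('a) \<le> (LINT x:ball 0 q|lborel. u0 x)" "0 < q" "q < s"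
    using eventually_happens'[OF trivial_limit_at_right_real] by fastforce
  have "0 < \<kappa> * q ^ DIM('a)" using \<kappa> q by simp
  also note q(1)
  also have "(LINT x:ball 0 q|lborel. u0 x) \<le> (LINT x:ball 0 s|lborel. u0 x)"
    unfolding set_lebesgue_integral_def
  proof (rule integral_mono_AE[OF int int])
    show "AE x in lborel. indicator (ball 0 q) x *\<^sub>R u0 x \<le> indicator (ball 0 s) x *\<^sub>R u0 x"
      using nonneg by eventually_elim (use q in \<open>auto simp: indicator_def\<close>)
  qed
  finally show ?thesis using s by (simp add: scale_f_def)
qed

text \<open>With the identity for \<open>h\<close> this transfers the mass bound to the
  representative, with a power the absorption bound. Monotonicity of \<open>h\<close> turns the
  bound on \<open>v\<close> into the bound needed for Fubini's theorem.\<close>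

lemma rescale_sol_iterated_integral:
  fixes u :: "'a::euclidean_space \<Rightarrow> real \<Rightarrow> real" and h :: "real \<Rightarrow> real"
  assumes u: "nonlocal_solution J p u0 u" and v: "regular_solution K \<mu> p' v"
    and eq: "AE x in lborel. \<forall>t\<ge>0. v (x, t) = rescale_sol u0 u r x t"
    and h: "h \<in> borel_measurable borel" and h_mono: "mono_on {0..} h" and h0: "\<And>s. 0 \<le> s \<Longrightarrow> 0 \<le> h s"
  shows "(LINT t:{0<..<\<tau>}|lborel. (LINT x:ball 0 R|lborel. h (rescale_sol u0 u r x t))) =
      (LINT z:ball 0 R \<times> {0<..<\<tau>}|lborel. h (v z))"
proof -
  have v_meas: "v \<in> borel_measurable borel" and v0: "\<And>z. 0 \<le> v z"
    and v_bd: "\<exists>M. \<forall>x. \<forall>t\<le>\<tau>. v (x, t) \<le> M"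
    using v unfolding regular_solution_def by blast+
  obtain M where M: "\<forall>x. \<forall>t\<le>\<tau>. v (x, t) \<le> M" using v_bd by (rule exE)
  have slice: "(LINT x:ball 0 R|lborel. h (rescale_sol u0 u r x t)) = (LINT x:ball 0 R|lborel. h (v (x, t)))"
    if t: "t \<in> {0<..<\<tau>}" for t
    unfolding set_lebesgue_integral_def
  proof (rule integral_cong_AE)
    have "(\<lambda>x. rescale_sol u0 u r x t) \<in> borel_measurable borel"
      using measurable_compose[OF _ rescale_sol_measurable[OF u], of "\<lambda>x. (x, t)" borel] t by (simp add: max_def)
    from measurable_compose[OF this h]
    show "(\<lambda>x. indicator (ball 0 R) x *\<^sub>R h (rescale_sol u0 u r x t)) \<in> borel_measurable lborel"
      by (intro borel_measurable_scaleR borel_measurable_indicator) simp_all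
    have "(\<lambda>x. v (x, t)) \<in> borel_measurable borel"
      using measurable_compose[OF _ v_meas, of "\<lambda>x. (x, t)" borel] by simp
    from measurable_compose[OF this h]
    show "(\<lambda>x. indicator (ball 0 R) x *\<^sub>R h (v (x, t))) \<in> borel_measurable lborel"
      by (intro borel_measurable_scaleR borel_measurable_indicator) simp_all
    show "AE x in lborel. indicator (ball 0 R) x *\<^sub>R h (rescale_sol u0 u r x t) =
        indicator (ball 0 R) x *\<^sub>R h (v (x, t))"
      using eq by eventually_elim (use t in simp)
  qed
  have "(LINT t:{0<..<\<tau>}|lborel. (LINT x:ball 0 R|lborel. h (rescale_sol u0 u r x t))) =
      (LINT t:{0<..<\<tau>}|lborel. (LINT x:ball 0 R|lborel. h (v (x, t))))"
    by (rule set_lebesgue_integral_cong) (use slice in auto)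
  also have "\<dots> = (LINT z:ball 0 R \<times> {0<..<\<tau>}|lborel. h (v z))"
  proof (rule set_lborel_integral_Times)
    show "(\<lambda>z. h (v z)) \<in> borel_measurable borel" by (rule measurable_compose[OF v_meas h])
    show "\<bar>h (v (x, t))\<bar> \<le> h M" if "t \<in> {0<..<\<tau>}" for x t
    proof -
      have "v (x, t) \<le> M" using M that by simp
      then have "h (v (x, t)) \<le> h M" using v0[of "(x, t)"] by (intro mono_onD[OF h_mono]) auto
      then show ?thesis using h0[OF v0] by simp
    qed
  qed auto
  finally show ?thesis .
qed

theorem proposition3p3:
  fixes J :: "'a::euclidean_space \<Rightarrow> real"
    and u0 :: "'a \<Rightarrow> real"
    and u U :: "'a \<Rightarrow> real \<Rightarrow> real"
    and \<phi> :: "('a \<Rightarrow> real) \<Rightarrow> real"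
    and k :: "nat \<Rightarrow> real"
    and p \<kappa> B k0 c0 :: real
  assumes J_test: "test_function_on UNIV J"
    and J_radial: "\<And>x y. norm x = norm y \<Longrightarrow> J x = J y"
    and J_nonneg: "\<And>x. 0 \<le> J x"
    and J_mass: "(LINT x|lborel. J x) = 1"
    and p: "1 < p"
    and u0_measurable: "u0 \<in> borel_measurable borel"
    and u0_bounded: "\<exists>M. AE x in lborel. u0 x \<le> M"
    and u0_nonneg: "AE x in lborel. 0 \<le> u0 x"
    and u0_nonzero: "\<not> (AE x in lborel. u0 x = 0)"
    and \<kappa>: "0 < \<kappa>"
    and u0_origin: "\<forall>\<^sub>F r in at_right 0. \<kappa> * r ^ DIM('a) \<le> (LINT x:ball 0 r|lborel. u0 x)"
    and F1: "0 < B" "AE x in lborel. scale_f u0 (norm x) * u0 x \<le> B"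
    and F2: "0 < k0"
      "\<And>\<delta>. 0 < \<delta> \<Longrightarrow> \<exists>C>0. \<forall>r l. k0 \<le> r \<and> r \<le> l / \<delta> \<longrightarrow> scale_f u0 r \<le> C * scale_f u0 l"
    and F3: "0 \<le> c0" "(scale_F p u0 \<longlongrightarrow> c0) at_top"
    and u: "nonlocal_solution J p u0 u"
    and k: "filterlim k at_top sequentially"
    and U: "\<And>K. compact K \<Longrightarrow> K \<subseteq> UNIV \<times> {0<..} \<Longrightarrow>
      uniform_limit K (\<lambda>n (x, t). rescale_sol u0 u (k n) x t) (\<lambda>(x, t). U x t) sequentially"
    and bounds: "\<And>R. 0 < R \<Longrightarrow> \<exists>C.
      (\<forall>\<tau>>0. \<forall>r>0.
         (LINT t:{0<..<\<tau>}|lborel. (LINT x:ball 0 R|lborel. rescale_sol u0 u r x t)) \<le> C * \<tau>) \<and>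
      ((\<exists>\<gamma>>0. \<forall>\<tau>>0. \<forall>r>0.
         scale_F p u0 r *
           (LINT t:{0<..<\<tau>}|lborel. (LINT x:ball 0 R|lborel. rescale_sol u0 u r x t powr p))
         \<le> C * \<tau> powr \<gamma>) \<or>
       (\<forall>R'>0. \<forall>\<tau>>0.
         ((\<lambda>r. scale_F p u0 r *
           (LINT t:{0<..<\<tau>}|lborel. (LINT x:ball 0 R'|lborel. rescale_sol u0 u r x t powr p)))
         \<longlongrightarrow> 0) at_top))"
    and \<phi>: "tendsto_distr (rescale_data u0) \<phi> at_top"
  shows "limit_solution (diffusivity J) c0 p \<phi> U"
proof -
  have f_pos: "0 < scale_f u0 s" if "0 < s" for s
    using u0_measurable u0_bounded u0_nonneg \<kappa> u0_origin that by (rule scale_f_pos)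
  have J_cont: "continuous_on UNIV J" and "compact (supp J)"
    using J_test by (auto simp: test_function_on_def intro: smooth_continuous_on)
  then obtain \<rho> where \<rho>: "0 < \<rho>" "\<And>x. x \<in> supp J \<Longrightarrow> norm x \<le> \<rho>"
    using compact_imp_bounded[of "supp J"] unfolding bounded_pos by blast
  have J_supp: "J z = 0" if "\<rho> < norm z" for z
    using that closure_subset[of "{x. J x \<noteq> 0}"] \<rho>(2)[of z] unfolding supp_def by auto
  have J_meas: "J \<in> borel_measurable borel"
    using J_cont by (rule borel_measurable_continuous_onI)
  \<comment> \<open>The sequence tends to infinity but its first terms may fail to be positive, and
    the scaling needs positive factors. Dropping them does not affect the limit.\<close>
  obtain m where m: "\<And>n. m \<le> n \<Longrightarrow> 0 < k n"
    using k unfolding filterlim_at_top_dense eventually_sequentially by blast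
  define r where "r n = k (n + m)" for n
  have r_pos: "0 < r n" for n using m[of "n + m"] by (simp add: r_def)
  have r_lim: "filterlim r at_top sequentially"
    unfolding r_def using k by (rule filterlim_compose) (rule filterlim_add_const_nat_at_top)
  have "\<forall>n. \<exists>v. regular_solution (scaled_kernel J (r n)) (scale_F p u0 (r n)) p v \<and>
    (AE x in lborel. \<forall>t\<ge>0. v (x, t) = rescale_sol u0 u (r n) x t) \<and>
    (AE x in lborel. v (x, 0) = rescale_data u0 (r n) x)"
  proof
    fix n
    show "\<exists>v. regular_solution (scaled_kernel J (r n)) (scale_F p u0 (r n)) p v \<and>
      (AE x in lborel. \<forall>t\<ge>0. v (x, t) = rescale_sol u0 u (r n) x t) \<and>
      (AE x in lborel. v (x, 0) = rescale_data u0 (r n) x)"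
      using J_meas u r_pos[of n] f_pos[OF r_pos[of n]] by (rule rescale_sol_regular) (intro exI conjI)
  qed
  then obtain v where v: "\<forall>n. regular_solution (scaled_kernel J (r n)) (scale_F p u0 (r n)) p (v n) \<and>
    (AE x in lborel. \<forall>t\<ge>0. v n (x, t) = rescale_sol u0 u (r n) x t) \<and>
    (AE x in lborel. v n (x, 0) = rescale_data u0 (r n) x)"
    by (rule choice[THEN exE])
  note v_regular = v[THEN spec, THEN conjunct1]
    and v_sol = v[THEN spec, THEN conjunct2, THEN conjunct1]
    and v_data = v[THEN spec, THEN conjunct2, THEN conjunct2]
  \<comment> \<open>One set of full measure on which all representatives agree with the rescaled
    solutions at all nonnegative times; on it the assumed uniform convergence carries over to
    \<open>v\<close>.\<close>
  define G where "G = {x. \<forall>n. \<forall>t\<ge>0. v n (x, t) = rescale_sol u0 u (r n) x t}"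
  have G: "AE x in lborel. x \<in> G"
    unfolding G_def mem_Collect_eq AE_all_countable using v_sol by (intro allI)
  have conv: "\<forall>\<^sub>F n in sequentially. \<forall>z\<in>Q. \<bar>rescale_sol u0 u (r n) (fst z) (snd z) - U (fst z) (snd z)\<bar> < e"
    if "compact Q" "Q \<subseteq> UNIV \<times> {0<..}" "0 < e" for Q and e :: real
    using eventually_sequentially_seg[THEN iffD2, OF uniform_limitD[OF U[OF that(1,2)] that(3)], of m]
    unfolding r_def by (simp add: dist_real_def case_prod_unfold)
  \<comment> \<open>For positive times \<open>U\<close> is a pointwise limit of Borel functions; it
    inherits measurability from the rescaled solutions frozen for negative times.\<close>
  have U_meas: "(\<lambda>z. if 0 < snd z then U (fst z) (snd z) else 0) \<in> borel_measurable borel"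
  proof (rule borel_measurable_LIMSEQ_real)
    fix z :: "'a \<times> real"
    show "(\<lambda>n. if 0 < snd z then rescale_sol u0 u (r n) (fst z) (max 0 (snd z)) else 0)
        \<longlonglongrightarrow> (if 0 < snd z then U (fst z) (snd z) else 0)"
    proof (cases "0 < snd z")
      case True
      have "(\<lambda>n. rescale_sol u0 u (r n) (fst z) (snd z)) \<longlonglongrightarrow> U (fst z) (snd z)"
      proof (rule tendstoI)
        fix e :: real assume "0 < e"
        then have "\<forall>\<^sub>F n in sequentially. \<forall>z\<in>{z}. \<bar>rescale_sol u0 u (r n) (fst z) (snd z) - U (fst z) (snd z)\<bar> < e"
          using True by (intro conv) (auto simp: mem_Times_iff)
        then show "\<forall>\<^sub>F n in sequentially. dist (rescale_sol u0 u (r n) (fst z) (snd z)) (U (fst z) (snd z)) < e"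
          by (simp add: dist_real_def)
      qed
      then show ?thesis using True by (simp add: max_def)
    qed simp
  next
    fix n
    have "{z :: 'a \<times> real. 0 < snd z} \<in> sets borel"
      by (intro borel_open open_Collect_less continuous_intros)
    then show "(\<lambda>z. if 0 < snd z then rescale_sol u0 u (r n) (fst z) (max 0 (snd z)) else 0) \<in> borel_measurable borel"
      by (intro measurable_If rescale_sol_measurable[OF u]) (simp_all)
  qed
  have slice: "(LINT t:{0<..<\<tau>}|lborel. (LINT x:ball 0 R|lborel. rescale_sol u0 u (r n) x t powr q)) =
      (LINT z:ball 0 R \<times> {0<..<\<tau>}|lborel. v n z powr q)" if "0 < q" for \<tau> R n q
    using that by (intro rescale_sol_iterated_integral[OF u v_regular v_sol, where h = "\<lambda>s. s powr q"])
      (auto intro!: mono_onI powr_mono2)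
  have slice1: "(LINT t:{0<..<\<tau>}|lborel. (LINT x:ball 0 R|lborel. rescale_sol u0 u (r n) x t)) =
      (LINT z:ball 0 R \<times> {0<..<\<tau>}|lborel. v n z)" for \<tau> R n
    by (intro rescale_sol_iterated_integral[OF u v_regular v_sol, where h = "\<lambda>s. s"]) (auto intro: mono_onI)
  have "rescaled_limit J \<rho> p c0 r (\<lambda>n. scale_F p u0 (r n)) v (\<lambda>z. U (fst z) (snd z)) G \<phi>"
  proof
    show "J x = J y" if "norm x = norm y" for x y using that by (rule J_radial)
    show "continuous_on UNIV J" "0 < \<rho>" "1 < p" by fact+
    show "0 \<le> J z" for z by (rule J_nonneg)
    show "J z = 0" if "\<rho> < norm z" for z using that by (rule J_supp)
    show "0 < r n" for n by (rule r_pos)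
    show "filterlim r at_top sequentially" by (rule r_lim)
    show "regular_solution (scaled_kernel J (r n)) (scale_F p u0 (r n)) p (v n)" for n by (rule v_regular)
    show "0 \<le> scale_F p u0 (r n)" for n by (simp add: scale_F_def)
    show "(\<lambda>n. scale_F p u0 (r n)) \<longlonglongrightarrow> c0" using F3(2) r_lim by (rule filterlim_compose)
    show "(\<lambda>z. if 0 < snd z then U (fst z) (snd z) else 0) \<in> borel_measurable borel" by (rule U_meas)
    show "AE x in lborel. x \<in> G" by (rule G)
    show "\<forall>\<^sub>F n in sequentially. \<forall>z\<in>Q. fst z \<in> G \<longrightarrow> \<bar>v n z - U (fst z) (snd z)\<bar> < e"
      if Q: "compact Q" "Q \<subseteq> UNIV \<times> {0<..}" "0 < e" for Q e
      using conv[OF that]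
    proof (eventually_elim, intro ballI impI)
      fix n z assume n: "\<forall>z\<in>Q. \<bar>rescale_sol u0 u (r n) (fst z) (snd z) - U (fst z) (snd z)\<bar> < e"
        and z: "z \<in> Q" "fst z \<in> G"
      have "0 \<le> snd z" using z(1) Q(2) by auto
      then have "v n (fst z, snd z) = rescale_sol u0 u (r n) (fst z) (snd z)"
        using z(2) unfolding G_def by blast
      then show "\<bar>v n z - U (fst z) (snd z)\<bar> < e" using n z(1) by simp
    qed
    show "\<exists>C. \<forall>\<tau>>0. \<forall>n. (LINT z:ball 0 R \<times> {0<..<\<tau>}|lborel. v n z) \<le> C * \<tau>" if R: "0 < R" for R
    proof -
      obtain C where C: "\<forall>\<tau>>0. \<forall>r>0.
         (LINT t:{0<..<\<tau>}|lborel. (LINT x:ball 0 R|lborel. rescale_sol u0 u r x t)) \<le> C * \<tau>"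
        using bounds[OF R] by (elim exE conjE) (rule that)
      show ?thesis
        unfolding slice1[symmetric] by (intro exI[of _ C] allI impI C[rule_format] r_pos)
    qed
    show "\<exists>L. (L \<longlongrightarrow> 0) (at_right 0) \<and> (\<forall>\<tau>>0. \<forall>e>0. \<forall>\<^sub>F n in sequentially.
      scale_F p u0 (r n) * (LINT z:ball 0 R \<times> {0<..<\<tau>}|lborel. v n z powr p) \<le> L \<tau> + e)" if R: "0 < R" for R
    proof -
      have p0: "0 < p" using p by simp
      obtain C where "(\<exists>\<gamma>>0. \<forall>\<tau>>0. \<forall>r>0.
         scale_F p u0 r *
           (LINT t:{0<..<\<tau>}|lborel. (LINT x:ball 0 R|lborel. rescale_sol u0 u r x t powr p))
         \<le> C * \<tau> powr \<gamma>) \<or>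
       (\<forall>R'>0. \<forall>\<tau>>0.
         ((\<lambda>r. scale_F p u0 r *
           (LINT t:{0<..<\<tau>}|lborel. (LINT x:ball 0 R'|lborel. rescale_sol u0 u r x t powr p)))
         \<longlongrightarrow> 0) at_top)"
        using bounds[OF R] by (elim exE conjE) (rule that)
      \<comment> \<open>The alternative is resolved separately for each \<open>R\<close>. In the
        first case the inequality holds for every \<open>n\<close>; in the second it holds only
        eventually and up to a slack, which dictates the form of \<open>absorption\<close>.\<close>
      then show ?thesis
      proof (elim disjE exE conjE)
        fix \<gamma> :: real assume \<gamma>: "0 < \<gamma>" and le: "\<forall>\<tau>>0. \<forall>r>0. scale_F p u0 r *
           (LINT t:{0<..<\<tau>}|lborel. (LINT x:ball 0 R|lborel. rescale_sol u0 u r x t powr p)) \<le> C * \<tau> powr \<gamma>"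
        have "((\<lambda>\<tau>. \<tau> powr \<gamma>) \<longlongrightarrow> 0) (at_right 0)"
          using \<gamma> by (intro tendsto_zero_powrI[where b = \<gamma>] tendsto_intros)
             (auto simp: eventually_at_right_less intro: eventually_mono[OF eventually_at_right_less[of 0]])
        then have "((\<lambda>\<tau>. C * \<tau> powr \<gamma>) \<longlongrightarrow> 0) (at_right 0)" by (rule tendsto_mult_right_zero)
        moreover have "scale_F p u0 (r n) * (LINT z:ball 0 R \<times> {0<..<\<tau>}|lborel. v n z powr p) \<le> C * \<tau> powr \<gamma> + e"
          if "0 < \<tau>" "0 < e" for \<tau> e n
        proof -
          have "scale_F p u0 (r n) * (LINT z:ball 0 R \<times> {0<..<\<tau>}|lborel. v n z powr p) \<le> C * \<tau> powr \<gamma>"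
            using le that(1) r_pos[of n] unfolding slice[OF p0, symmetric] by blast
          then show ?thesis using that(2) by linarith
        qed
        ultimately show ?thesis by (intro exI[of _ "\<lambda>\<tau>. C * \<tau> powr \<gamma>"]) simp
      next
        assume lim: "\<forall>R'>0. \<forall>\<tau>>0. ((\<lambda>r. scale_F p u0 r *
           (LINT t:{0<..<\<tau>}|lborel. (LINT x:ball 0 R'|lborel. rescale_sol u0 u r x t powr p))) \<longlongrightarrow> 0) at_top"
        have "\<forall>\<^sub>F n in sequentially.
          scale_F p u0 (r n) * (LINT z:ball 0 R \<times> {0<..<\<tau>}|lborel. v n z powr p) \<le> 0 + e" if "0 < \<tau>" "0 < e" for \<tau> e
        proof -
          have "(\<lambda>n. scale_F p u0 (r n) * (LINT z:ball 0 R \<times> {0<..<\<tau>}|lborel. v n z powr p)) \<longlonglongrightarrow> 0"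
            unfolding slice[OF p0, symmetric]
            by (rule filterlim_compose[OF lim[rule_format, OF R that(1)] r_lim])
          from order_tendstoD(2)[OF this that(2)] show ?thesis by eventually_elim simp
        qed
        then show ?thesis by (intro exI[of _ "\<lambda>_. 0"]) simp
      qed
    qed
    show "(\<lambda>n. LINT x|lborel. v n (x, 0) * \<psi> x) \<longlonglongrightarrow> \<phi> \<psi>" if \<psi>: "test_function_on UNIV \<psi>" for \<psi>
    proof -
      have [measurable]: "\<psi> \<in> borel_measurable borel"
        using \<psi> by (auto simp: test_function_on_def intro: borel_measurable_continuous_onI smooth_continuous_on)
      have "(LINT x|lborel. v n (x, 0) * \<psi> x) = (LINT x|lborel. rescale_data u0 (r n) x * \<psi> x)" for n
      proof (rule integral_cong_AE)
        have "(\<lambda>x. v n (x, 0)) \<in> borel_measurable borel"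
          using v_regular[of n] measurable_compose[of "\<lambda>x. (x, 0)" borel borel "v n" borel]
          by (simp add: regular_solution_def)
        then show "(\<lambda>x. v n (x, 0) * \<psi> x) \<in> borel_measurable lborel"
          by (intro borel_measurable_times) simp_all
        note [measurable] = u0_measurable
        show "(\<lambda>x. rescale_data u0 (r n) x * \<psi> x) \<in> borel_measurable lborel"
          unfolding rescale_data_def by measurable
        show "AE x in lborel. v n (x, 0) * \<psi> x = rescale_data u0 (r n) x * \<psi> x"
          using v_data[of n] by eventually_elim simp
      qed
      moreover have "((\<lambda>s. LINT x|lborel. rescale_data u0 s x * \<psi> x) \<longlongrightarrow> \<phi> \<psi>) at_top"
        using \<phi> \<psi> unfolding tendsto_distr_def by blast
      ultimately show ?thesis
        by (simp only:) (rule filterlim_compose[OF _ r_lim])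
    qed
  qed
  from rescaled_limit.U_limit_solution[OF this] show ?thesis by simp
qed

end
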